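(* For every $0\le b\le 1$, the function $t_b(V)=b^{H(V)}$ on the set of all pair-partitions $\mathcal{P}_2(\infty)=\bigcup_n\mathcal{P}_2(2n)$ is strongly multiplicative, tracable and positive definite.
   Context: $\mathcal{P}_2(2n)$ is the set of pair-partitions of $\{1,\dots,2n\}$ (partitions into $n$ blocks of size two, each block written $(i,j)$ with $i<j$), $n\ge1$. A pair-partition of an arbitrary finite totally ordered set with $2n$ elements is identified with an element of $\mathcal{P}_2(2n)$ through the order-preserving bijection. Two blocks $(i_1,j_1),(i_2,j_2)$ cross if $i_1<i_2<j_1<j_2$ or $i_2<i_1<j_2<j_1$. A block of $V$ is a singleton if it crosses no other block of $V$; $h(V)$ is the number of singletons of $V$, and $H(V)=n-h(V)$ for $V\in\mathcal{P}_2(2n)$. Convention: $0^0=1$. Let $t:\mathcal{P}_2(\infty)\to\mathbb{C}$. $t$ is strongly multiplicative if $t(V_1\cup V_2)=t(V_1)t(V_2)$ whenever $V_1,V_2$ are pair-partitions of disjoint finite sets of integers such that no block of $V_1$ crosses a block of $V_2$. $t$ is tracable if $t(V)=t(\overrightarrow{V})$ for all $n$ and all $V\in\mathcal{P}_2(2n)$, where $\overrightarrow{V}\in\mathcal{P}_2(2n)$ is the cyclic rotation of $V$, obtained by applying $i\mapsto i+1$ (modulo $2n$) to all elements of all blocks. $t$ is positive definite if for every real Hilbert space $\mathcal{H}$ there exist a unital $*$-algebra $\mathcal{A}$ with a state $\varepsilon$ and a family $G(f)=G(f)^*\in\mathcal{A}$, $f\in\mathcal{H}$, such that for all $k\ge1$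 and $f_1,\dots,f_k\in\mathcal{H}$, $\varepsilon(G(f_1)\cdots G(f_k))=0$ if $k$ is odd and $\varepsilon(G(f_1)\cdots G(f_{k}))=\sum_{V\in\mathcal{P}_2(2n)}t(V)\prod_{(i,j)\in V}\langle f_i|f_j\rangle$ if $k=2n$. *)

theory Defs
  imports
    "HOL-Analysis.Inner_Product"
    "HOL-Library.Disjoint_Sets"
    "HOL-Library.Nonpos_Ints"
    "HOL-Algebra.Module"
begin

section \<open>Pair partitions\<close>

definition pair_partition_on :: "'a set \<Rightarrow> 'a set set \<Rightarrow> bool" where
  "pair_partition_on X V \<longleftrightarrow> partition_on X V \<and> (\<forall>B\<in>V. card B = 2)"

definition P2 :: "nat \<Rightarrow> nat set set set" where
  "P2 n = {V. pair_partition_on {1..2 * n} V}"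

definition crosses :: "'a::linorder set \<Rightarrow> 'a set \<Rightarrow> bool" where
  "crosses B C \<longleftrightarrow> (\<exists>i1 j1 i2 j2. B = {i1, j1} \<and> C = {i2, j2} \<and>
     (i1 < i2 \<and> i2 < j1 \<and> j1 < j2 \<or> i2 < i1 \<and> i1 < j2 \<and> j2 < j1))"

text \<open>
  For finite \<open>X\<close>, the function \<open>rank X\<close> is the order-preserving bijection from \<open>X\<close> onto
  \<open>{1..card X}\<close> (\<open>rank_bij_betw\<close>, \<open>rank_strict_mono_on\<close>), and \<open>standardize\<close> is the induced
  identification of the pair partitions of a set with \<open>2 * n\<close> elements with those in \<open>P2 n\<close>.
\<close>

definition rank :: "'a::linorder set \<Rightarrow> 'a \<Rightarrow> nat" where
  "rank X x = card {y \<in> X. y \<le> x}"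

definition standardize :: "'a::linorder set set \<Rightarrow> nat set set" where
  "standardize V = (\<lambda>B. rank (\<Union>V) ` B) ` V"

definition rotate_pp :: "nat \<Rightarrow> nat set set \<Rightarrow> nat set set" where
  "rotate_pp n V = (\<lambda>B. (\<lambda>i. if i = 2 * n then 1 else i + 1) ` B) ` V"

definition num_singletons :: "'a::linorder set set \<Rightarrow> nat" where
  "num_singletons V = card {B \<in> V. \<forall>C \<in> V - {B}. \<not> crosses B C}"

text \<open>For \<open>V \<in> P2 n\<close> one has \<open>card V = n\<close>, and the subtraction does not truncate.\<close>

definition H :: "'a::linorder set set \<Rightarrow> nat" where
  "H V = card V - num_singletons V"

definition t_fun :: "real \<Rightarrow> nat set set \<Rightarrow> complex" where
  "t_fun b V = of_real b ^ H V"


section \<open>Functions on pair partitions\<close>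

text \<open>
  A function on \<open>\<Union>n\<ge>1. P2 n\<close> is represented by a function on \<open>nat set set\<close>; the definitions
  below only evaluate it on elements of \<open>P2 n\<close> with \<open>n \<ge> 1\<close>.
\<close>

definition strongly_multiplicative :: "(nat set set \<Rightarrow> complex) \<Rightarrow> bool" where
  "strongly_multiplicative t \<longleftrightarrow>
     (\<forall>(X1 :: int set) X2 V1 V2.
        finite X1 \<and> X1 \<noteq> {} \<and> pair_partition_on X1 V1 \<and>
        finite X2 \<and> X2 \<noteq> {} \<and> pair_partition_on X2 V2 \<and>
        X1 \<inter> X2 = {} \<and> (\<forall>B\<in>V1. \<forall>C\<in>V2. \<not> crosses B C) \<longrightarrow>
        t (standardize (V1 \<union> V2)) = t (standardize V1) * t (standardize V2))"

definition tracable :: "(nat set set \<Rightarrow> complex) \<Rightarrow> bool" where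
  "tracable t \<longleftrightarrow> (\<forall>n\<ge>1. \<forall>V\<in>P2 n. t V = t (rotate_pp n V))"


section \<open>Unital *-algebras and states\<close>

definition complex_ring :: "complex ring" where
  "complex_ring = \<lparr>carrier = UNIV, monoid.mult = (*), one = 1, zero = 0, add = (+)\<rparr>"

record 'b star_algebra = "(complex, 'b) module" +
  star :: "'b \<Rightarrow> 'b"

text \<open>The locale \<open>algebra\<close> of the library requires a commutative multiplication.\<close>

locale unital_star_algebra =
  module complex_ring A + ring A for A (structure) +
  assumes smult_mult_left:
      "\<lbrakk>x \<in> carrier A; y \<in> carrier A\<rbrakk> \<Longrightarrow> (c \<odot> x) \<otimes> y = c \<odot> (x \<otimes> y)"
    and smult_mult_right:
      "\<lbrakk>x \<in> carrier A; y \<in> carrier A\<rbrakk> \<Longrightarrow> x \<otimes> (c \<odot> y) = c \<odot> (x \<otimes> y)"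
    and star_closed: "x \<in> carrier A \<Longrightarrow> star A x \<in> carrier A"
    and star_star: "x \<in> carrier A \<Longrightarrow> star A (star A x) = x"
    and star_add:
      "\<lbrakk>x \<in> carrier A; y \<in> carrier A\<rbrakk> \<Longrightarrow> star A (x \<oplus> y) = star A x \<oplus> star A y"
    and star_smult: "x \<in> carrier A \<Longrightarrow> star A (c \<odot> x) = cnj c \<odot> star A x"
    and star_mult:
      "\<lbrakk>x \<in> carrier A; y \<in> carrier A\<rbrakk> \<Longrightarrow> star A (x \<otimes> y) = star A y \<otimes> star A x"

locale star_algebra_state = unital_star_algebra +
  fixes \<epsilon> :: "'a \<Rightarrow> complex"
  assumes state_add: "\<lbrakk>x \<in> carrier A; y \<in> carrier A\<rbrakk> \<Longrightarrow> \<epsilon> (x \<oplus> y) = \<epsilon> x + \<epsilon> y"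
    and state_smult: "x \<in> carrier A \<Longrightarrow> \<epsilon> (c \<odot> x) = c * \<epsilon> x"
    and state_one: "\<epsilon> \<one> = 1"
    and state_nonneg: "x \<in> carrier A \<Longrightarrow> \<epsilon> (star A x \<otimes> x) \<in> \<real>\<^sub>\<ge>\<^sub>0"


section \<open>Positive definiteness\<close>

definition mprod :: "('b, 'z) monoid_scheme \<Rightarrow> 'b list \<Rightarrow> 'b" where
  "mprod A xs = foldr (mult A) xs (one A)"

locale generalized_gaussian = star_algebra_state A \<epsilon>
  for A :: "('b, 'z) star_algebra_scheme" (structure) and \<epsilon> :: "'b \<Rightarrow> complex" +
  fixes t :: "nat set set \<Rightarrow> complex" and G :: "'h::real_inner \<Rightarrow> 'b"
  assumes G_closed: "G f \<in> carrier A"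
    and G_selfadjoint: "star A (G f) = G f"
    and moment_odd:
      "odd k \<Longrightarrow> \<epsilon> (mprod A (map (\<lambda>i. G (fs i)) [1..<Suc k])) = 0"
    and moment_even:
      "n \<ge> 1 \<Longrightarrow> \<epsilon> (mprod A (map (\<lambda>i. G (fs i)) [1..<Suc (2 * n)])) =
         (\<Sum>V\<in>P2 n. t V * of_real (\<Prod>B\<in>V. inner (fs (Min B)) (fs (Max B))))"

text \<open>
  The real Hilbert space is the type \<open>'h\<close>; a statement about \<open>positive_definite\<close> with a free type
  variable of sort \<open>{real_inner, complete_space}\<close> is a statement about every real Hilbert space.

  HOL cannot quantify over the type of the elements of the *-algebra. Here they are formal complex
  linear combinations of words in \<open>'h\<close>. This is no restriction: the *-subalgebra generated by the
  \<open>G f\<close> consists of linear combinations of words in the \<open>G f\<close>, so that every realization, on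
  whatever type, yields one with a carrier of this type (\<open>positive_definiteI\<close>).
\<close>

definition positive_definite ::
  "'h::{real_inner, complete_space} itself \<Rightarrow> (nat set set \<Rightarrow> complex) \<Rightarrow> bool" where
  "positive_definite (_ :: 'h itself) t \<longleftrightarrow>
     (\<exists>(A :: (complex \<times> 'h list) list star_algebra) \<epsilon> (G :: 'h \<Rightarrow> _).
        generalized_gaussian A \<epsilon> t G)"


section \<open>Consistency of the encodings\<close>

lemma rank_strict_mono_on:
  assumes "finite X"
  shows "strict_mono_on X (rank X)"
proof (rule strict_mono_onI)
  fix x y assume "x \<in> X" "y \<in> X" "x < y"
  then have "y \<in> {z \<in> X. z \<le> y}" "y \<notin> {z \<in> X. z \<le> x}"
    and "{z \<in> X. z \<le> x} \<subseteq> {z \<in> X. z \<le> y}"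
    by auto
  then have "{z \<in> X. z \<le> x} \<subset> {z \<in> X. z \<le> y}"
    by blast
  then show "rank X x < rank X y"
    unfolding rank_def using assms by (intro psubset_card_mono) auto
qed

lemma rank_bij_betw:
  assumes "finite X"
  shows "bij_betw (rank X) X {1..card X}"
proof -
  have inj: "inj_on (rank X) X"
    using rank_strict_mono_on[OF assms] by (rule strict_mono_on_imp_inj_on)
  have "rank X ` X \<subseteq> {1..card X}"
  proof safe
    fix x assume x: "x \<in> X"
    have "card {x} \<le> rank X x"
      unfolding rank_def using assms x by (intro card_mono) auto
    moreover have "rank X x \<le> card X"
      unfolding rank_def using assms by (intro card_mono) auto
    ultimately show "rank X x \<in> {1..card X}" by simp
  qed
  moreover have "card (rank X ` X) = card {1..card X}"
    using card_image[OF inj] by simp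
  ultimately have "rank X ` X = {1..card X}"
    by (intro card_subset_eq) auto
  with inj show ?thesis by (simp add: bij_betw_def)
qed

lemma cring_complex_ring: "cring complex_ring"
proof (rule cringI)
  show "abelian_group complex_ring"
  proof (rule abelian_groupI)
    fix x assume "x \<in> carrier complex_ring"
    show "\<exists>y\<in>carrier complex_ring. y \<oplus>\<^bsub>complex_ring\<^esub> x = \<zero>\<^bsub>complex_ring\<^esub>"
      by (rule bexI[of _ "- x"]) (auto simp: complex_ring_def)
  qed (auto simp: complex_ring_def)
  show "comm_monoid complex_ring"
    by (rule comm_monoidI) (auto simp: complex_ring_def)
qed (auto simp: complex_ring_def algebra_simps)

context unital_star_algebra
begin

lemma csmult_closed: "x \<in> carrier A \<Longrightarrow> c \<odot> x \<in> carrier A"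
  using smult_closed[of c x] by (simp add: complex_ring_def)

lemma csmult_add: "x \<in> carrier A \<Longrightarrow> (c + d) \<odot> x = c \<odot> x \<oplus> d \<odot> x"
  using smult_l_distr[of c d x] by (simp add: complex_ring_def)

lemma csmult_distrib:
  "\<lbrakk>x \<in> carrier A; y \<in> carrier A\<rbrakk> \<Longrightarrow> c \<odot> (x \<oplus> y) = c \<odot> x \<oplus> c \<odot> y"
  using smult_r_distr[of c x y] by (simp add: complex_ring_def)

lemma csmult_assoc: "x \<in> carrier A \<Longrightarrow> (c * d) \<odot> x = c \<odot> (d \<odot> x)"
  using smult_assoc1[of c d x] by (simp add: complex_ring_def)

lemma csmult_one: "x \<in> carrier A \<Longrightarrow> 1 \<odot> x = x"
  using smult_one[of x] by (simp add: complex_ring_def)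

lemma csmult_zero: "x \<in> carrier A \<Longrightarrow> 0 \<odot> x = \<zero>"
  using smult_l_null[of x] by (simp add: complex_ring_def)

lemma csmult_zero_right: "c \<odot> \<zero> = \<zero>"
  using smult_r_null[of c] by (simp add: complex_ring_def)

lemma csmult_minus_one:
  assumes "x \<in> carrier A"
  shows "((-1) \<odot> x) \<oplus> x = \<zero>"
proof -
  have "((-1) \<odot> x) \<oplus> x = ((-1) + 1) \<odot> x"
    using assms by (simp only: csmult_add csmult_one)
  then show ?thesis using assms by (simp add: csmult_zero)
qed

lemma star_zero: "star A \<zero> = \<zero>"
  using star_smult[of \<zero> 0] by (simp add: csmult_zero star_closed)

lemma star_one: "star A \<one> = \<one>"
proof -
  have "star A \<one> = star A \<one> \<otimes> star A (star A \<one>)"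
    by (simp add: star_star star_closed)
  also have "\<dots> = star A (star A \<one> \<otimes> \<one>)"
    by (rule star_mult [symmetric]) (simp_all add: star_closed)
  also have "\<dots> = \<one>"
    by (simp add: star_star star_closed)
  finally show ?thesis .
qed

lemma mprod_closed: "set xs \<subseteq> carrier A \<Longrightarrow> mprod A xs \<in> carrier A"
  by (induction xs) (auto simp: mprod_def)

lemma mprod_append:
  "\<lbrakk>set xs \<subseteq> carrier A; set ys \<subseteq> carrier A\<rbrakk> \<Longrightarrow>
     mprod A (xs @ ys) = mprod A xs \<otimes> mprod A ys"
proof (induction xs)
  case Nil
  then show ?case using mprod_closed[of ys] by (simp add: mprod_def)
next
  case (Cons x xs)
  then show ?case using mprod_closed[of xs] mprod_closed[of ys]
    by (simp add: mprod_def m_assoc)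
qed

lemma star_mprod:
  "\<lbrakk>set xs \<subseteq> carrier A; \<And>x. x \<in> set xs \<Longrightarrow> star A x = x\<rbrakk> \<Longrightarrow>
     star A (mprod A xs) = mprod A (rev xs)"
proof (induction xs)
  case Nil
  then show ?case by (simp add: mprod_def star_one)
next
  case (Cons x xs)
  have "star A (mprod A (x # xs)) = star A (x \<otimes> mprod A xs)"
    by (simp add: mprod_def)
  also have "\<dots> = mprod A (rev xs) \<otimes> x"
    using Cons mprod_closed[of xs] by (simp add: star_mult)
  also have "\<dots> = mprod A (rev xs) \<otimes> mprod A [x]"
    using Cons.prems by (simp add: mprod_def)
  also have "\<dots> = mprod A (rev (x # xs))"
    using Cons.prems mprod_append[of "rev xs" "[x]"] by simp
  finally show ?case .
qed

end

lemma generalized_gaussian_transport: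
  fixes A :: "('b, 'z) star_algebra_scheme" (structure)
    and G :: "'h::real_inner \<Rightarrow> 'b" and r :: "'b \<Rightarrow> 'c" and e :: "'c \<Rightarrow> 'b"
  assumes "generalized_gaussian A \<epsilon> t G"
    and S: "S \<subseteq> carrier A" "\<zero> \<in> S" "\<one> \<in> S" "\<And>f. G f \<in> S"
    and S_add: "\<And>x y. x \<in> S \<Longrightarrow> y \<in> S \<Longrightarrow> x \<oplus> y \<in> S"
    and S_mult: "\<And>x y. x \<in> S \<Longrightarrow> y \<in> S \<Longrightarrow> x \<otimes> y \<in> S"
    and S_smult: "\<And>c x. x \<in> S \<Longrightarrow> c \<odot> x \<in> S"
    and S_star: "\<And>x. x \<in> S \<Longrightarrow> star A x \<in> S"
    and er: "\<And>x. x \<in> S \<Longrightarrow> e (r x) = x"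
  defines "B \<equiv> \<lparr>carrier = r ` S, monoid.mult = (\<lambda>x y. r (e x \<otimes> e y)), one = r \<one>,
      zero = r \<zero>, add = (\<lambda>x y. r (e x \<oplus> e y)), smult = (\<lambda>c x. r (c \<odot> e x)),
      star = (\<lambda>x. r (star A (e x)))\<rparr>"
  shows "generalized_gaussian B (\<lambda>x. \<epsilon> (e x)) t (\<lambda>f. r (G f))"
proof -
  interpret generalized_gaussian A \<epsilon> t G by fact
  have SA: "x \<in> carrier A" if "x \<in> S" for x using S(1) that by blast
  note [simp] = S S_add S_mult S_smult S_star er SA
  have abel: "abelian_group B"
  proof (rule abelian_groupI)
    fix x assume "x \<in> carrier B"
    then obtain u where u: "x = r u" "u \<in> S" by (auto simp: B_def)
    show "\<exists>y\<in>carrier B. y \<oplus>\<^bsub>B\<^esub> x = \<zero>\<^bsub>B\<^esub>"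
      using u by (intro bexI[of _ "r ((-1) \<odot> u)"]) (auto simp: B_def csmult_minus_one)
  qed (auto simp: B_def a_assoc intro!: arg_cong[where f = r] a_comm)
  have "monoid B"
    by (rule monoidI) (auto simp: B_def m_assoc)
  then have rB: "ring B"
    using abel
    by (intro ringI) (auto simp: B_def l_distr r_distr monoid.m_closed)
  have modB: "module complex_ring B"
    using abel
    by (intro moduleI cring_complex_ring)
       (auto simp: B_def complex_ring_def csmult_add csmult_distrib csmult_assoc
          csmult_one)
  have alg: "unital_star_algebra B"
    by (intro unital_star_algebra.intro modB rB unital_star_algebra_axioms.intro)
       (auto simp: B_def smult_mult_left smult_mult_right star_star star_add star_smult star_mult)
  have st: "star_algebra_state B (\<lambda>x. \<epsilon> (e x))"
    by (intro star_algebra_state.intro alg star_algebra_state_axioms.intro)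
       (auto simp: B_def state_add state_smult state_one state_nonneg)
  have mp: "mprod A (map G gs) \<in> S \<and> mprod B (map (\<lambda>f. r (G f)) gs) = r (mprod A (map G gs))"
    for gs
    by (induction gs) (auto simp: mprod_def B_def)
  have mp': "\<epsilon> (e (mprod B (map (\<lambda>i. r (G (fs i))) is))) = \<epsilon> (mprod A (map (\<lambda>i. G (fs i)) is))"
    for fs :: "nat \<Rightarrow> 'h" and "is"
    using mp[of "map fs is"] by (simp add: comp_def)
  show ?thesis
  proof (intro generalized_gaussian.intro st generalized_gaussian_axioms.intro)
    show "r (G f) \<in> carrier B" "star B (r (G f)) = r (G f)" for f
      by (auto simp: B_def G_selfadjoint)
  qed (unfold mp', fact moment_odd, fact moment_even)
qed

lemma positive_definiteI:
  fixes A :: "('b, 'z) star_algebra_scheme"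
    and G :: "'h::{real_inner, complete_space} \<Rightarrow> 'b"
  assumes "generalized_gaussian A \<epsilon> t G"
  shows "positive_definite TYPE('h) t"
proof -
  interpret generalized_gaussian A \<epsilon> t G by fact
  define word where "word w = mprod A (map G w)" for w
  define ev where "ev l = foldr (\<lambda>(c, w) a. (c \<odot>\<^bsub>A\<^esub> word w) \<oplus>\<^bsub>A\<^esub> a) l \<zero>\<^bsub>A\<^esub>"
    for l :: "(complex \<times> 'h list) list"
  have [simp]: "word w \<in> carrier A" for w
    unfolding word_def by (intro mprod_closed) (auto simp: G_closed)
  have word_append: "word (v @ w) = word v \<otimes>\<^bsub>A\<^esub> word w" for v w
    unfolding word_def by (simp, subst mprod_append) (auto simp: G_closed)
  have star_word: "star A (word w) = word (rev w)" for w
    unfolding word_def by (subst star_mprod) (auto simp: G_closed G_selfadjoint rev_map)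
  note [simp] = csmult_closed
  have ev_Nil: "ev [] = \<zero>\<^bsub>A\<^esub>" by (simp add: ev_def)
  have ev_Cons: "ev ((c, w) # l) = (c \<odot>\<^bsub>A\<^esub> word w) \<oplus>\<^bsub>A\<^esub> ev l" for c w l
    by (simp add: ev_def)
  have ev_closed [simp]: "ev l \<in> carrier A" for l
    by (induction l) (auto simp: ev_Nil ev_Cons)
  have ev_append: "ev (l @ m) = ev l \<oplus>\<^bsub>A\<^esub> ev m" for l m
    by (induction l) (auto simp: ev_Nil ev_Cons a_assoc)
  have ev_smult: "c \<odot>\<^bsub>A\<^esub> ev l = ev (map (\<lambda>(d, w). (c * d, w)) l)" for c l
    by (induction l)
       (auto simp: ev_Nil ev_Cons csmult_zero_right csmult_distrib csmult_assoc)
  have ev_star: "star A (ev l) = ev (map (\<lambda>(d, w). (cnj d, rev w)) l)" for l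
    by (induction l) (auto simp: ev_Nil ev_Cons star_zero star_add star_smult star_word)
  have ev_term: "(c \<odot>\<^bsub>A\<^esub> word v) \<otimes>\<^bsub>A\<^esub> ev m = ev (map (\<lambda>(d, w). (c * d, v @ w)) m)" for c v m
    by (induction m)
       (auto simp: ev_Nil ev_Cons r_distr smult_mult_left smult_mult_right csmult_assoc
          csmult_distrib word_append)
  have ev_mult: "\<exists>k. ev l \<otimes>\<^bsub>A\<^esub> ev m = ev k" for l m
  proof (induction l)
    case Nil
    then show ?case by (auto simp: ev_Nil intro: exI[of _ "[]"])
  next
    case (Cons a l)
    then obtain k where k: "ev l \<otimes>\<^bsub>A\<^esub> ev m = ev k" by blast
    obtain c v where a: "a = (c, v)" by (cases a)
    have "ev (a # l) \<otimes>\<^bsub>A\<^esub> ev m = ev (map (\<lambda>(d, w). (c * d, v @ w)) m @ k)"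
      by (simp add: a ev_Cons l_distr k ev_term ev_append)
    then show ?case by blast
  qed
  have ev_word: "ev [(1, w)] = word w" for w
    by (simp add: ev_Nil ev_Cons csmult_one)
  define r where "r = inv_into UNIV ev"
  show ?thesis
    unfolding positive_definite_def
  proof (intro exI)
    show "generalized_gaussian
      \<lparr>carrier = r ` range ev, monoid.mult = (\<lambda>x y. r (ev x \<otimes>\<^bsub>A\<^esub> ev y)), one = r \<one>\<^bsub>A\<^esub>,
       zero = r \<zero>\<^bsub>A\<^esub>, add = (\<lambda>x y. r (ev x \<oplus>\<^bsub>A\<^esub> ev y)), smult = (\<lambda>c x. r (c \<odot>\<^bsub>A\<^esub> ev x)),
       star = (\<lambda>x. r (star A (ev x)))\<rparr> (\<lambda>x. \<epsilon> (ev x)) t (\<lambda>f. r (G f))"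
    proof (rule generalized_gaussian_transport[OF assms])
      show "\<zero>\<^bsub>A\<^esub> \<in> range ev" using ev_Nil by (metis rangeI)
      show "\<one>\<^bsub>A\<^esub> \<in> range ev" using ev_word[of "[]"] by (metis rangeI word_def mprod_def
            list.simps(8) foldr.simps(1) id_apply)
      show "G f \<in> range ev" for f
        using ev_word[of "[f]"] G_closed[of f] unfolding word_def mprod_def by (simp, metis rangeI)
      show "x \<oplus>\<^bsub>A\<^esub> y \<in> range ev" if "x \<in> range ev" "y \<in> range ev" for x y
        using that by (auto simp flip: ev_append)
      show "x \<otimes>\<^bsub>A\<^esub> y \<in> range ev" if "x \<in> range ev" "y \<in> range ev" for x y
        using that ev_mult by (auto simp: image_iff)
      show "c \<odot>\<^bsub>A\<^esub> x \<in> range ev" if "x \<in> range ev" for c x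
        using that by (auto simp: ev_smult)
      show "star A x \<in> range ev" if "x \<in> range ev" for x
        using that by (auto simp: ev_star)
      show "ev (r x) = x" if "x \<in> range ev" for x
        unfolding r_def using that by (rule f_inv_into_f)
    qed auto
  qed
qed

end

theory Submission
  imports Defs "HOL-Library.Poly_Mapping" "HOL-Library.Multiset" "HOL-Analysis.Linear_Algebra"
begin

text \<open>
  Strong multiplicativity and traciality hold because \<open>H V\<close> is the number of blocks that cross some
  other block, and crossing is invariant under monotone relabelling and under rotation.

  For positive definiteness, write each singleton's weight as \<open>1 = b + (1 - b)\<close>: then \<open>b ^ H V\<close> is the
  sum over all sets \<open>D\<close> of blocks crossing nothing of \<open>b\<close> to the number of blocks outside \<open>D\<close> times
  \<open>(1 - b)\<close> to the number of blocks in \<open>D\<close>. These are the moments of \<open>sqrt b X + sqrt (1 - b) Y\<close> for a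
  bosonic Gaussian \<open>X\<close> and a semicircular \<open>Y\<close> that are free. Concretely, the field acts by a
  symmetric matrix on a Fock space in which creators of the bosonic colour commute with each other only,
  and scanning the positions of \<open>V\<close> from right to left identifies its vacuum moments with the sum over
  \<open>(V, D)\<close>. Symmetry of the matrix makes the moment functional a sum of squares.
\<close>

section \<open>The free *-algebra\<close>

text \<open>With concatenation as addition, the convolution product on
  \<open>'h list \<Rightarrow>\<^sub>0 complex\<close> is the product of the free algebra on the
  letters \<open>'h\<close>, with \<open>0\<close> the empty word.\<close>

instantiation list :: (type) monoid_add
begin
definition "zero_list = []"
definition "plus_list = (@)"
instance by standard (auto simp: zero_list_def plus_list_def)
end

text \<open>Every finitely supported function is a sum of monomials, so identities additive in each
  argument need checking on \<open>single\<close> only.\<close>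

lemma poly_mapping_add_induct [case_names zero single add]:
  assumes "P 0" and "\<And>k c. P (Poly_Mapping.single k c)" and "\<And>p q. P p \<Longrightarrow> P q \<Longrightarrow> P (p + q)"
  shows "P (p :: 'a \<Rightarrow>\<^sub>0 'b::comm_monoid_add)"
proof (induction p rule: update_induct)
  case const
  then show ?case using assms(1) by simp
next
  case (update p a b)
  have "Poly_Mapping.update a b p = p + Poly_Mapping.single a b"
    using update.hyps
    by (intro poly_mapping_eqI) (auto simp: lookup_update lookup_add lookup_single when_def in_keys_iff)
  then show ?case using assms update.IH by simp
qed

text \<open>Words are reversed and coefficients conjugated, so the involution is antimultiplicative
  and each generator \<open>single [f] 1\<close> is self-adjoint.\<close>

definition poly_star :: "('h list \<Rightarrow>\<^sub>0 complex) \<Rightarrow> 'h list \<Rightarrow>\<^sub>0 complex" where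
  "poly_star p = Poly_Mapping.map cnj (Poly_Mapping.map_key rev p)"

lemma lookup_poly_star: "Poly_Mapping.lookup (poly_star p) w = cnj (Poly_Mapping.lookup p (rev w))"
  by (simp add: poly_star_def map.rep_eq map_key.rep_eq when_def)

lemma poly_star_add: "poly_star (p + q) = poly_star p + poly_star q"
  by (intro poly_mapping_eqI) (simp add: lookup_poly_star lookup_add)

lemma poly_star_single: "poly_star (Poly_Mapping.single w c) = Poly_Mapping.single (rev w) (cnj c)"
  by (intro poly_mapping_eqI) (auto simp: lookup_poly_star lookup_single when_def)

lemma poly_star_zero: "poly_star 0 = 0"
  by (intro poly_mapping_eqI) (simp add: lookup_poly_star)

lemma poly_star_mult: "poly_star (p * q) = poly_star q * poly_star p"
proof (induction p rule: poly_mapping_add_induct)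
  case (single k c)
  show ?case
    by (induction q rule: poly_mapping_add_induct)
       (simp_all add: mult_single poly_star_single plus_list_def poly_star_add distrib_left
          distrib_right poly_star_zero mult.commute)
qed (simp_all add: poly_star_zero poly_star_add distrib_left distrib_right)

lemma mult_single_zero_commute:
  fixes p :: "'h list \<Rightarrow>\<^sub>0 complex"
  shows "p * Poly_Mapping.single 0 c = Poly_Mapping.single 0 c * p"
  by (induction p rule: poly_mapping_add_induct)
     (simp_all add: mult_single mult.commute distrib_left distrib_right)

section \<open>Linear functionals on the free algebra\<close>

definition poly_eval :: "('h list \<Rightarrow> complex) \<Rightarrow> ('h list \<Rightarrow>\<^sub>0 complex) \<Rightarrow> complex" where
  "poly_eval \<phi> p = (\<Sum>w\<in>Poly_Mapping.keys p. Poly_Mapping.lookup p w * \<phi> w)"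

lemma poly_eval_zero [simp]: "poly_eval \<phi> 0 = 0"
  by (simp add: poly_eval_def)

lemma poly_eval_single [simp]: "poly_eval \<phi> (Poly_Mapping.single w c) = c * \<phi> w"
  by (simp add: poly_eval_def)

lemma poly_eval_add: "poly_eval \<phi> (p + q) = poly_eval \<phi> p + poly_eval \<phi> q"
  unfolding poly_eval_def
  by (rule setsum_keys_plus_distrib) (simp_all add: distrib_right)

lemma poly_eval_smult: "poly_eval \<phi> (Poly_Mapping.single 0 c * p) = c * poly_eval \<phi> p"
  by (induction p rule: poly_mapping_add_induct)
     (simp_all add: mult_single poly_eval_add distrib_left)

text \<open>Turns positivity of the functional into positive semidefiniteness of the kernel
  \<open>\<phi> (rev u @ v)\<close> on words, the form in which it is verified later.\<close>

lemma poly_eval_star_mult: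
  "poly_eval \<phi> (poly_star p * q) =
     (\<Sum>u\<in>Poly_Mapping.keys p. \<Sum>v\<in>Poly_Mapping.keys q.
        cnj (Poly_Mapping.lookup p u) * Poly_Mapping.lookup q v * \<phi> (rev u @ v))"
proof (induction p rule: poly_mapping_add_induct)
  case zero
  show ?case by (simp add: poly_star_zero)
next
  case (single k c)
  show ?case
  proof (induction q rule: poly_mapping_add_induct)
    case (add p q)
    let ?F = "\<lambda>q. \<Sum>v\<in>Poly_Mapping.keys q. cnj c * Poly_Mapping.lookup q v * \<phi> (rev k @ v)"
    have "?F (p + q) = ?F p + ?F q"
      by (rule setsum_keys_plus_distrib) (simp_all add: algebra_simps)
    \<comment> \<open>\<open>single k c\<close> has no keys when \<open>c = 0\<close>, so the outer
      sum collapses to the word \<open>k\<close> only for nonzero \<open>c\<close>.\<close>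
    then show ?case using add
      by (cases "c = 0") (simp_all add: distrib_left poly_eval_add poly_star_zero)
  qed (simp_all add: poly_star_single mult_single plus_list_def)
next
  case (add p p')
  let ?F = "\<lambda>p. \<Sum>u\<in>Poly_Mapping.keys p. \<Sum>v\<in>Poly_Mapping.keys q.
    cnj (Poly_Mapping.lookup p u) * Poly_Mapping.lookup q v * \<phi> (rev u @ v)"
  have "?F (p + p') = ?F p + ?F p'"
    by (rule setsum_keys_plus_distrib) (simp_all add: algebra_simps sum.distrib)
  then show ?case using add by (simp add: distrib_right poly_eval_add poly_star_add)
qed

definition free_star_algebra :: "('h list \<Rightarrow>\<^sub>0 complex) star_algebra" where
  "free_star_algebra = \<lparr>carrier = UNIV, monoid.mult = (*), one = 1, zero = 0, add = (+),
     smult = (\<lambda>c p. Poly_Mapping.single 0 c * p), star = poly_star\<rparr>"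

lemma unital_star_algebra_free: "unital_star_algebra free_star_algebra"
proof -
  have abel: "abelian_group free_star_algebra"
  proof (rule abelian_groupI)
    fix x :: "'h list \<Rightarrow>\<^sub>0 complex"
    show "\<exists>y\<in>carrier free_star_algebra. y \<oplus>\<^bsub>free_star_algebra\<^esub> x = \<zero>\<^bsub>free_star_algebra\<^esub>"
      by (rule bexI[of _ "- x"]) (auto simp: free_star_algebra_def)
  qed (auto simp: free_star_algebra_def algebra_simps)
  have "monoid free_star_algebra"
    by (rule monoidI) (auto simp: free_star_algebra_def mult.assoc)
  then have ring: "ring free_star_algebra"
    using abel by (intro ringI) (auto simp: free_star_algebra_def algebra_simps)
  have module: "module complex_ring free_star_algebra"
    using abel
    by (intro moduleI cring_complex_ring)
       (auto simp: free_star_algebra_def complex_ring_def single_add algebra_simps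
          mult_single mult.assoc[symmetric])
  show ?thesis
    by (intro unital_star_algebra.intro module ring unital_star_algebra_axioms.intro)
       (auto simp: free_star_algebra_def mult.assoc poly_star_add poly_star_mult poly_star_single
          poly_mapping_eq_iff fun_eq_iff lookup_poly_star zero_list_def
          mult_single_zero_commute[unfolded zero_list_def] simp flip: mult.assoc)
qed

lemma star_algebra_state_free:
  assumes one: "\<phi> [] = 1"
    and pos: "\<And>S c. finite S \<Longrightarrow>
      (\<Sum>u\<in>S. \<Sum>v\<in>S. cnj (c u) * c v * \<phi> (rev u @ v)) \<in> \<real>\<^sub>\<ge>\<^sub>0"
  shows "star_algebra_state free_star_algebra (poly_eval \<phi>)"
proof (intro star_algebra_state.intro unital_star_algebra_free star_algebra_state_axioms.intro)
  have "poly_eval \<phi> (Poly_Mapping.single 0 1) = 1"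
    using one by (simp add: zero_list_def del: single_one)
  then show "poly_eval \<phi> \<one>\<^bsub>free_star_algebra\<^esub> = 1"
    by (simp add: free_star_algebra_def)
qed (auto simp: free_star_algebra_def poly_eval_add poly_eval_smult poly_eval_star_mult pos)

lemma mprod_free_star_algebra:
  "mprod free_star_algebra (map (\<lambda>f. Poly_Mapping.single [f] 1) fs) = Poly_Mapping.single fs 1"
  by (induction fs)
     (simp_all add: mprod_def free_star_algebra_def mult_single plus_list_def flip: single_one,
      simp add: zero_list_def)

text \<open>
  No GNS construction is needed: a positive normalized functional on the free algebra is a state.
\<close>


lemma positive_definite_of_moments:
  fixes \<phi> :: "'h::{real_inner, complete_space} list \<Rightarrow> complex"
  assumes "\<phi> [] = 1"
    and "\<And>S c. finite S \<Longrightarrow> (\<Sum>u\<in>S. \<Sum>v\<in>S. cnj (c u) * c v * \<phi> (rev u @ v)) \<in> \<real>\<^sub>\<ge>\<^sub>0"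
    and odd: "\<And>w. odd (length w) \<Longrightarrow> \<phi> w = 0"
    and even: "\<And>n fs. n \<ge> 1 \<Longrightarrow> \<phi> (map fs [1..<Suc (2 * n)]) =
      (\<Sum>V\<in>P2 n. t V * of_real (\<Prod>B\<in>V. inner (fs (Min B)) (fs (Max B))))"
  shows "positive_definite TYPE('h) t"
proof -
  have mp: "mprod free_star_algebra (map (\<lambda>i. Poly_Mapping.single [fs i] 1) is)
      = Poly_Mapping.single (map fs is) 1" for fs :: "nat \<Rightarrow> 'h" and "is"
    using mprod_free_star_algebra[of "map fs is"] by (simp add: comp_def)
  have "generalized_gaussian free_star_algebra (poly_eval \<phi>) t (\<lambda>f. Poly_Mapping.single [f] 1)"
  proof (intro generalized_gaussian.intro star_algebra_state_free generalized_gaussian_axioms.intro)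
    fix k :: nat and fs :: "nat \<Rightarrow> 'h" assume "odd k"
    then show "poly_eval \<phi> (mprod free_star_algebra
        (map (\<lambda>i. Poly_Mapping.single [fs i] 1) [1..<Suc k])) = 0"
      by (simp add: mp odd del: upt_Suc)
  next
    fix n :: nat and fs :: "nat \<Rightarrow> 'h" assume "1 \<le> n"
    then show "poly_eval \<phi> (mprod free_star_algebra
        (map (\<lambda>i. Poly_Mapping.single [fs i] 1) [1..<Suc (2 * n)])) =
        (\<Sum>V\<in>P2 n. t V * of_real (\<Prod>B\<in>V. inner (fs (Min B)) (fs (Max B))))"
      by (simp only: mp poly_eval_single mult_1 even)
  qed (use assms in \<open>auto simp: free_star_algebra_def poly_star_single\<close>)
  then show ?thesis by (rule positive_definiteI)
qed

section \<open>Crossings\<close>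

text \<open>The inequalities in \<open>crosses\<close> force each block to be written with its
  smaller element first, so ordered endpoints determine the witnesses.\<close>

lemma crosses_iff:
  assumes "i1 < j1" "i2 < j2"
  shows "crosses {i1, j1} {i2, j2} \<longleftrightarrow> i1 < i2 \<and> i2 < j1 \<and> j1 < j2 \<or> i2 < i1 \<and> i1 < j2 \<and> j2 < j1"
proof
  assume "crosses {i1, j1} {i2, j2}"
  then show "i1 < i2 \<and> i2 < j1 \<and> j1 < j2 \<or> i2 < i1 \<and> i1 < j2 \<and> j2 < j1"
    using assms unfolding crosses_def doubleton_eq_iff by (elim exE conjE disjE) auto
qed (unfold crosses_def, blast)

lemma crosses_commute: "crosses B C \<longleftrightarrow> crosses C B"
  unfolding crosses_def by blast

lemma not_crosses_self: "\<not> crosses B B"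
  unfolding crosses_def by (auto simp: doubleton_eq_iff)

lemma card_2_less_obtain:
  fixes B :: "'a::linorder set"
  assumes "card B = 2"
  obtains i j where "B = {i, j}" "i < j"
proof -
  obtain x y where "B = {x, y}" "x \<noteq> y"
    using assms by (auto simp: card_2_iff)
  then show ?thesis
    using that[of x y] that[of y x] by (cases "x < y") (auto simp: insert_commute)
qed

lemma pair_partition_onD:
  assumes "pair_partition_on X V"
  shows "\<Union>V = X" and "\<And>B. B \<in> V \<Longrightarrow> B \<subseteq> X" and "\<And>B. B \<in> V \<Longrightarrow> card B = 2"
    and "\<And>B C. B \<in> V \<Longrightarrow> C \<in> V \<Longrightarrow> B \<noteq> C \<Longrightarrow> B \<inter> C = {}"
  using assms unfolding pair_partition_on_def partition_on_def disjoint_def by auto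

lemma pair_partition_onI:
  assumes "\<Union>V = X" "\<And>B. B \<in> V \<Longrightarrow> card B = 2"
    "\<And>B C. B \<in> V \<Longrightarrow> C \<in> V \<Longrightarrow> B \<noteq> C \<Longrightarrow> B \<inter> C = {}"
  shows "pair_partition_on X V"
  using assms(2)[of "{}"] assms unfolding pair_partition_on_def partition_on_def disjoint_def by auto

lemma pair_partition_on_finite:
  assumes "pair_partition_on X V" "finite X"
  shows "finite V"
  using finite_UnionD assms pair_partition_onD(1) by metis

lemma pair_partition_on_insert:
  assumes "pair_partition_on X V" "card B = 2" "B \<inter> X = {}"
  shows "pair_partition_on (B \<union> X) (insert B V)"
proof (rule pair_partition_onI)
  show "\<Union> (insert B V) = B \<union> X" "C \<in> insert B V \<Longrightarrow> card C = 2" for C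
    using assms pair_partition_onD[OF assms(1)] by auto
  show "C \<inter> D = {}" if "C \<in> insert B V" "D \<in> insert B V" "C \<noteq> D" for C D
  proof -
    have "B \<inter> E = {}" if "E \<in> V" for E
      using that assms(3) pair_partition_onD(2)[OF assms(1)] by blast
    then show ?thesis
      using that pair_partition_onD(4)[OF assms(1)] by blast
  qed
qed

lemma pair_partition_on_remove:
  assumes "pair_partition_on X V" "B \<in> V"
  shows "pair_partition_on (X - B) (V - {B})"
proof (rule pair_partition_onI)
  show "\<Union> (V - {B}) = X - B"
    using pair_partition_onD[OF assms(1)] assms(2) by blast
qed (use pair_partition_onD[OF assms(1)] in auto)

lemma pair_partition_on_even:
  assumes "pair_partition_on X V" "finite X"
  shows "even (card X)"
proof -
  have "card (\<Union>V) = (\<Sum>B\<in>V. card B)"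
    using pair_partition_onD[OF assms(1)] assms
    by (intro card_Union_disjoint) (auto simp: pairwise_def disjnt_def intro: finite_subset)
  then show ?thesis
    using pair_partition_onD(1,3)[OF assms(1)] by simp
qed

text \<open>Since no block crosses itself, the complement of the singletons consists of the blocks
  that cross some block. This form avoids the truncated subtraction and carries over under maps
  preserving crossings.\<close>

lemma H_eq_card_crossing:
  assumes "finite V"
  shows "H V = card {B \<in> V. \<exists>C\<in>V. crosses B C}"
proof -
  have "{B \<in> V. \<exists>C\<in>V. crosses B C} = V - {B \<in> V. \<forall>C\<in>V - {B}. \<not> crosses B C}"
    using not_crosses_self by fastforce
  then show ?thesis
    using assms by (simp add: H_def num_singletons_def card_Diff_subset)
qed

section \<open>Invariance and additivity of the number of crossing blocks\<close>

lemma H_image: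
  assumes "finite V" "inj_on g V" "\<And>B C. B \<in> V \<Longrightarrow> C \<in> V \<Longrightarrow> crosses (g B) (g C) \<longleftrightarrow> crosses B C"
  shows "H (g ` V) = H V"
proof -
  have "{B \<in> g ` V. \<exists>C\<in>g ` V. crosses B C} = g ` {B \<in> V. \<exists>C\<in>V. crosses B C}"
    using assms(3) by auto
  moreover have "inj_on g {B \<in> V. \<exists>C\<in>V. crosses B C}"
    using assms(2) by (rule inj_on_subset) auto
  ultimately show ?thesis
    using assms(1) by (simp add: H_eq_card_crossing card_image)
qed

lemma crosses_image_strict_mono_on:
  assumes "strict_mono_on X r" "B \<subseteq> X" "C \<subseteq> X" "card B = 2" "card C = 2"
  shows "crosses (r ` B) (r ` C) \<longleftrightarrow> crosses B C"
proof -
  obtain i1 j1 where B: "B = {i1, j1}" "i1 < j1" using assms(4) by (rule card_2_less_obtain)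
  obtain i2 j2 where C: "C = {i2, j2}" "i2 < j2" using assms(5) by (rule card_2_less_obtain)
  have r: "r x < r y \<longleftrightarrow> x < y" if "x \<in> X" "y \<in> X" for x y
    using assms(1) that by (rule strict_mono_on_less)
  show ?thesis
    using B C assms(2,3) by (simp add: crosses_iff r)
qed

lemma H_standardize:
  assumes "pair_partition_on X V" "finite X"
  shows "H (standardize V) = H V"
proof -
  note V = pair_partition_onD[OF assms(1)]
  have mono: "strict_mono_on X (rank X)"
    using assms(2) by (rule rank_strict_mono_on)
  have "inj_on (image (rank X)) V"
    using V(2) strict_mono_on_imp_inj_on[OF mono]
    by (intro inj_onI) (metis inj_on_image_eq_iff)
  then show ?thesis
    unfolding standardize_def V(1)
    using V(2,3) pair_partition_on_finite[OF assms] crosses_image_strict_mono_on[OF mono]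
    by (intro H_image) simp_all
qed

text \<open>By the non-crossing hypothesis a block can cross only blocks of its own partition, so
  \<open>H\<close> is additive and the powers of \<open>b\<close> multiply.\<close>

lemma strongly_multiplicative_t_fun: "strongly_multiplicative (t_fun b)"
  unfolding strongly_multiplicative_def
proof (intro allI impI, elim conjE)
  fix X1 X2 :: "int set" and V1 V2
  assume fin: "finite X1" "finite X2" and pp: "pair_partition_on X1 V1" "pair_partition_on X2 V2"
    and disj: "X1 \<inter> X2 = {}" and nc: "\<forall>B\<in>V1. \<forall>C\<in>V2. \<not> crosses B C"
  note V1 = pair_partition_onD[OF pp(1)] and V2 = pair_partition_onD[OF pp(2)]
  have "pair_partition_on (X1 \<union> X2) (V1 \<union> V2)"
  proof (rule pair_partition_onI)
    show "\<Union> (V1 \<union> V2) = X1 \<union> X2" "B \<in> V1 \<union> V2 \<Longrightarrow> card B = 2" for B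
      using V1(1,3) V2(1,3) by auto
    show "B \<inter> C = {}" if "B \<in> V1 \<union> V2" "C \<in> V1 \<union> V2" "B \<noteq> C" for B C
    proof -
      have "D \<inter> E = {}" if "D \<in> V1" "E \<in> V2" for D E
        using that V1(2) V2(2) disj by blast
      then show ?thesis
        using that V1(4)[of B C] V2(4)[of B C] by (metis Int_commute Un_iff)
    qed
  qed
  then have st: "H (standardize (V1 \<union> V2)) = H (V1 \<union> V2)"
    using fin by (intro H_standardize[of "X1 \<union> X2"]) auto
  have finV: "finite V1" "finite V2"
    using pp fin pair_partition_on_finite by blast+
  have "V1 \<inter> V2 = {}"
  proof (rule equals0I)
    fix B assume "B \<in> V1 \<inter> V2"
    then have "B \<subseteq> X1 \<inter> X2" "card B = 2" using V1(2,3) V2(2) by auto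
    then show False using disj by simp
  qed
  moreover have "{B \<in> V1 \<union> V2. \<exists>C\<in>V1 \<union> V2. crosses B C} =
      {B \<in> V1. \<exists>C\<in>V1. crosses B C} \<union> {B \<in> V2. \<exists>C\<in>V2. crosses B C}"
    using nc crosses_commute by blast
  ultimately have "H (V1 \<union> V2) = H V1 + H V2"
    using finV by (simp add: H_eq_card_crossing) (intro card_Un_disjoint, auto)
  then show "t_fun b (standardize (V1 \<union> V2)) = t_fun b (standardize V1) * t_fun b (standardize V2)"
    using st H_standardize[OF pp(1) fin(1)] H_standardize[OF pp(2) fin(2)]
    by (simp add: t_fun_def power_add)
qed

text \<open>A crossing means that the two pairs of endpoints separate each other on the circle, and
  rotation preserves the cyclic order.\<close>

lemma crosses_rotate:
  fixes n :: nat
  assumes "B \<subseteq> {1..2 * n}" "C \<subseteq> {1..2 * n}" "card B = 2" "card C = 2" "B \<inter> C = {}"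
  defines "\<rho> \<equiv> \<lambda>i. if i = 2 * n then 1 else i + 1"
  shows "crosses (\<rho> ` B) (\<rho> ` C) \<longleftrightarrow> crosses B C"
proof -
  obtain i1 j1 where B: "B = {i1, j1}" "i1 < j1" using assms(3) by (rule card_2_less_obtain)
  obtain i2 j2 where C: "C = {i2, j2}" "i2 < j2" using assms(4) by (rule card_2_less_obtain)
  \<comment> \<open>Only an upper endpoint can be \<open>2 * n\<close>; it wraps around to
    \<open>1\<close> and its partner becomes the new upper endpoint.\<close>
  have 1: "\<rho> ` B = (if j1 = 2 * n then {1, i1 + 1} else {i1 + 1, j1 + 1})"
    "\<rho> ` C = (if j2 = 2 * n then {1, i2 + 1} else {i2 + 1, j2 + 1})"
    using B C assms(1,2) by (auto simp: \<rho>_def)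
  have "0 < i1" "0 < i2" "j1 \<le> 2 * n" "j2 \<le> 2 * n" "i1 \<noteq> i2" "j1 \<noteq> j2" "i1 \<noteq> j2" "i2 \<noteq> j1"
    using B C assms(1,2,5) by auto
  then show ?thesis
    using B(2) C(2) unfolding 1 unfolding B(1) C(1) by (auto simp: crosses_iff)
qed

lemma tracable_t_fun: "tracable (t_fun b)"
  unfolding tracable_def
proof (intro allI impI ballI)
  fix n :: nat and V assume "1 \<le> n" "V \<in> P2 n"
  then have pp: "pair_partition_on {1..2 * n} V" by (simp add: P2_def)
  note V = pair_partition_onD[OF pp]
  let ?\<rho> = "\<lambda>i. if i = 2 * n then 1 else i + 1"
  have inj: "inj_on ?\<rho> {1..2 * n}"
    by (auto simp: inj_on_def)
  have "inj_on (image ?\<rho>) V"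
    using V(2) by (intro inj_onI) (rule iffD1[OF inj_on_image_eq_iff[OF inj V(2) V(2)]])
  moreover have "crosses (?\<rho> ` B) (?\<rho> ` C) \<longleftrightarrow> crosses B C" if "B \<in> V" "C \<in> V" for B C
  proof (cases "B = C")
    case False
    then show ?thesis using that V(2,3) V(4)[OF that] by (intro crosses_rotate) blast+
  qed (simp add: not_crosses_self)
  ultimately have "H (rotate_pp n V) = H V"
    unfolding rotate_pp_def using pair_partition_on_finite[OF pp] by (intro H_image) auto
  then show "t_fun b V = t_fun b (rotate_pp n V)"
    by (simp add: t_fun_def)
qed

text \<open>Expanding the product of \<open>(1 - b) + b\<close>, which is \<open>1\<close>, over the
  blocks that cross nothing selects a subset \<open>D\<close>; the other \<open>H V\<close> blocks
  contribute \<open>b\<close> each.\<close>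

lemma power_H_eq_sum:
  fixes b :: real
  assumes "finite V"
  shows "b ^ H V = (\<Sum>D | D \<subseteq> V \<and> (\<forall>B\<in>D. \<forall>C\<in>V. \<not> crosses B C).
           \<Prod>B\<in>V. if B \<in> D then 1 - b else b)"
proof -
  define S where "S = {B \<in> V. \<forall>C\<in>V. \<not> crosses B C}"
  have S: "S \<subseteq> V" "finite S" "finite (V - S)"
    using assms by (auto simp: S_def)
  have "(\<Sum>D\<in>Pow S. \<Prod>B\<in>V. if B \<in> D then 1 - b else b)
      = (\<Sum>D\<in>Pow S. b ^ H V * ((\<Prod>B\<in>D. 1 - b) * (\<Prod>B\<in>S - D. b)))"
  proof (rule sum.cong)
    fix D assume D: "D \<in> Pow S"
    let ?g = "\<lambda>B. if B \<in> D then 1 - b else b"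
    have "prod ?g V = prod ?g (V - S) * prod ?g S"
      using S assms by (simp add: prod.subset_diff)
    also have "prod ?g S = prod ?g (S - D) * prod ?g D"
      using D S by (simp add: prod.subset_diff)
    also have "prod ?g (V - S) = (\<Prod>B\<in>V - S. b)"
      using D by (intro prod.cong) auto
    also have "\<dots> = b ^ H V"
      using assms by (simp add: H_eq_card_crossing S_def set_diff_eq) (rule arg_cong, blast)
    finally show "prod ?g V = b ^ H V * ((\<Prod>B\<in>D. 1 - b) * (\<Prod>B\<in>S - D. b))"
      using D by simp
  qed simp
  also have "\<dots> = b ^ H V * (\<Prod>B\<in>S. (1 - b) + b)"
    using S(2) by (subst prod_add) (simp_all add: sum_distrib_left)
  finally have "b ^ H V = (\<Sum>D\<in>Pow S. \<Prod>B\<in>V. if B \<in> D then 1 - b else b)"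
    by simp
  moreover have "Pow S = {D. D \<subseteq> V \<and> (\<forall>B\<in>D. \<forall>C\<in>V. \<not> crosses B C)}"
    by (auto simp: S_def)
  ultimately show ?thesis by simp
qed

section \<open>Sums over coloured pairings with open positions\<close>

text \<open>
  In \<open>open_pairings k P Q\<close> the set \<open>P\<close> consists of positions above \<open>k\<close> whose partners are still to be
  chosen among \<open>1, \<dots>, k\<close>; \<open>D\<close> is the set of blocks of the free colour and \<open>Q\<close> the set of open positions
  of that colour.
\<close>

definition open_pairings :: "nat \<Rightarrow> nat set \<Rightarrow> nat set \<Rightarrow> (nat set set \<times> nat set set) set" where
  "open_pairings k P Q = {(V, D). pair_partition_on ({1..k} \<union> P) V \<and> (\<forall>B\<in>V. \<not> B \<subseteq> P) \<and>
     D \<subseteq> V \<and> (\<forall>B\<in>D. \<forall>C\<in>V. \<not> crosses B C) \<and> \<Union>D \<inter> P = Q}"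

definition pairing_weight :: "real \<Rightarrow> (nat \<Rightarrow> 'h::real_inner) \<Rightarrow> nat set set \<times> nat set set \<Rightarrow> real" where
  "pairing_weight b f = (\<lambda>(V, D). \<Prod>B\<in>V. (if B \<in> D then 1 - b else b) * inner (f (Min B)) (f (Max B)))"

definition pairing_sum :: "real \<Rightarrow> (nat \<Rightarrow> 'h::real_inner) \<Rightarrow> nat \<Rightarrow> nat set \<Rightarrow> nat set \<Rightarrow> real" where
  "pairing_sum b f k P Q = sum (pairing_weight b f) (open_pairings k P Q)"

text \<open>
  A block joining \<open>Suc k\<close> with \<open>p\<close> crosses exactly the blocks of the open positions below \<open>p\<close>, and
  a crossing is admissible iff neither block has the free colour.
\<close>

definition closable :: "nat set \<Rightarrow> nat set \<Rightarrow> nat set" where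
  "closable P Q = {p \<in> P. \<forall>q\<in>P. q < p \<longrightarrow> p \<notin> Q \<and> q \<notin> Q}"

lemma finite_open_pairings:
  assumes "finite P"
  shows "finite (open_pairings k P Q)"
proof (rule finite_subset)
  let ?X = "Pow ({1..k} \<union> P)"
  show "open_pairings k P Q \<subseteq> Pow ?X \<times> Pow ?X"
  proof clarify
    fix V D assume "(V, D) \<in> open_pairings k P Q"
    then have "V \<subseteq> ?X" "D \<subseteq> V"
      unfolding open_pairings_def using pair_partition_onD(2)[of "{1..k} \<union> P" V] by blast+
    then show "V \<in> Pow ?X \<and> D \<in> Pow ?X" by blast
  qed
qed (use assms in simp)

lemma open_pairings_0: "open_pairings 0 P Q = (if P = {} \<and> Q = {} then {({}, {})} else {})"
proof -
  have "V = {}" if "pair_partition_on P V" "\<forall>B\<in>V. \<not> B \<subseteq> P" for V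
    using that pair_partition_onD(2)[of P V] by blast
  moreover have "P = {}" if "pair_partition_on P {}"
    using that pair_partition_onD(1) by blast
  moreover have "pair_partition_on {} {}"
    by (rule pair_partition_onI) auto
  ultimately have "(V, D) \<in> open_pairings 0 P Q \<longleftrightarrow> V = {} \<and> D = {} \<and> P = {} \<and> Q = {}" for V D
    unfolding open_pairings_def by (cases "V = {}") auto
  then show ?thesis by auto
qed

text \<open>
  The block of \<open>Suc k\<close> either ends at an open position \<open>p\<close>, or starts at a position below \<open>Suc k\<close>,
  which makes \<open>Suc k\<close> an open position for the first \<open>k\<close> points.
\<close>

lemma open_pairings_insert:
  assumes "Suc k \<notin> P" "Q \<subseteq> P"
  shows "{(V, D) \<in> open_pairings (Suc k) P Q. \<forall>p\<in>P. {Suc k, p} \<notin> V} =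
    open_pairings k (insert (Suc k) P) Q \<union> open_pairings k (insert (Suc k) P) (insert (Suc k) Q)"
proof -
  have X: "{1..Suc k} \<union> P = {1..k} \<union> insert (Suc k) P"
    by auto
  \<comment> \<open>Once \<open>Suc k\<close> counts as open, the ban on blocks between open
    positions also excludes the pairs \<open>{Suc k, p}\<close>.\<close>
  have blocks: "(\<forall>B\<in>V. \<not> B \<subseteq> P) \<and> (\<forall>p\<in>P. {Suc k, p} \<notin> V) \<longleftrightarrow> (\<forall>B\<in>V. \<not> B \<subseteq> insert (Suc k) P)"
    if pp: "pair_partition_on ({1..k} \<union> insert (Suc k) P) V" for V
  proof -
    have "\<exists>p\<in>P. B = {Suc k, p}" if "B \<in> V" "B \<subseteq> insert (Suc k) P" "\<not> B \<subseteq> P" for B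
    proof -
      have "card B = 2" "Suc k \<in> B"
        using pair_partition_onD(3)[OF pp that(1)] that by auto
      then obtain p where "B = {Suc k, p}" "p \<noteq> Suc k"
        by (auto simp: card_2_iff doubleton_eq_iff)
      then show ?thesis using that by auto
    qed
    moreover have "\<not> B \<subseteq> P" if "\<not> B \<subseteq> insert (Suc k) P" for B
      using that by auto
    moreover have "{Suc k, p} \<subseteq> insert (Suc k) P" if "p \<in> P" for p
      using that by auto
    ultimately show ?thesis by metis
  qed
  \<comment> \<open>The block of \<open>Suc k\<close> may have either colour; this gives the two
    alternatives for the open positions of the free colour.\<close>
  have Q: "\<Union>D \<inter> P = Q \<longleftrightarrow>
      \<Union>D \<inter> insert (Suc k) P = Q \<or> \<Union>D \<inter> insert (Suc k) P = insert (Suc k) Q" for D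
  proof (cases "Suc k \<in> \<Union>D")
    case True
    then have "\<Union>D \<inter> insert (Suc k) P = insert (Suc k) (\<Union>D \<inter> P)" by blast
    moreover have "Suc k \<notin> Q" "Suc k \<notin> \<Union>D \<inter> P" using assms by auto
    ultimately show ?thesis by (metis insertI1 insert_ident)
  next
    case False
    then have "\<Union>D \<inter> insert (Suc k) P = \<Union>D \<inter> P" by blast
    then show ?thesis using False by (metis IntD1 insertI1)
  qed
  show ?thesis
  proof (rule Set.set_eqI)
    fix x :: "nat set set \<times> nat set set"
    obtain V D where x: "x = (V, D)" by (cases x)
    show "x \<in> {(V, D) \<in> open_pairings (Suc k) P Q. \<forall>p\<in>P. {Suc k, p} \<notin> V} \<longleftrightarrow>
      x \<in> open_pairings k (insert (Suc k) P) Q \<union> open_pairings k (insert (Suc k) P) (insert (Suc k) Q)"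
      unfolding x open_pairings_def X Un_iff mem_Collect_eq case_prod_conv
      using blocks[of V] Q[of D] by argo
  qed
qed

text \<open>One end of \<open>B\<close> lies to the left of \<open>Suc k\<close>, so only the
  location of the other end matters.\<close>

lemma crosses_Suc_iff:
  assumes "B = {j, p'}" "j \<le> k" "Suc k < p" "p' \<noteq> p" "p' \<noteq> Suc k" "j \<noteq> p'"
  shows "crosses {Suc k, p} B \<longleftrightarrow> Suc k < p' \<and> p' < p"
proof (cases "j < p'")
  case True
  then show ?thesis using assms by (auto simp: crosses_iff)
next
  case False
  then have "crosses {Suc k, p} {p', j} \<longleftrightarrow> Suc k < p' \<and> p' < p"
    using assms by (subst crosses_iff) auto
  then show ?thesis using assms by (simp add: insert_commute)
qed

text \<open>Adding the block \<open>{Suc k, p}\<close> respects every condition of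
  \<open>open_pairings\<close> except the absence of crossings with free blocks;
  \<open>closable\<close> records exactly that one.\<close>

lemma open_pairings_close_iff:
  assumes P: "P \<subseteq> {Suc k<..}" "Q \<subseteq> P" "p \<in> P" and B0: "B0 = {Suc k, p}" "B0 \<notin> V"
    "D \<subseteq> V"
  shows "(insert B0 V, if p \<in> Q then insert B0 D else D) \<in> open_pairings (Suc k) P Q \<longleftrightarrow>
    p \<in> closable P Q \<and> (V, D) \<in> open_pairings k (P - {p}) (Q - {p})"
    (is "(?V, ?D) \<in> _ \<longleftrightarrow> _")
proof -
  have p: "Suc k < p" and card: "card B0 = 2" using P B0 by auto
  have X: "({1..Suc k} \<union> P) - B0 = {1..k} \<union> (P - {p})" "B0 \<union> ({1..k} \<union> (P - {p})) = {1..Suc k} \<union> P"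
    using P B0 by auto
  have disj: "B0 \<inter> ({1..k} \<union> (P - {p})) = {}"
    using P B0 by auto
  have pp: "pair_partition_on ({1..Suc k} \<union> P) ?V \<longleftrightarrow> pair_partition_on ({1..k} \<union> (P - {p})) V"
    using pair_partition_on_insert[OF _ card disj, of V] B0(2)
      pair_partition_on_remove[of "{1..Suc k} \<union> P" ?V B0] unfolding X by auto
  show ?thesis
  proof (cases "pair_partition_on ({1..k} \<union> (P - {p})) V")
    case False
    then show ?thesis by (simp only: open_pairings_def pp mem_Collect_eq case_prod_conv simp_thms)
  next
    case True
    note V = pair_partition_onD[OF True]
    have B: "B0 \<inter> B = {}" if "B \<in> V" for B
      using V(2)[OF that] disj by blast
    have sub: "(\<forall>B\<in>?V. \<not> B \<subseteq> P) \<longleftrightarrow> (\<forall>B\<in>V. \<not> B \<subseteq> P - {p})"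
      using B B0 P p by auto
    have col: "\<Union>?D \<inter> P = Q \<longleftrightarrow> \<Union>D \<inter> (P - {p}) = Q - {p}"
    proof -
      have *: "p \<notin> \<Union>D" "Suc k \<notin> P" using B B0 P by auto
      show ?thesis
      proof (cases "p \<in> Q")
        case True
        then have "\<Union>?D \<inter> P = insert p (\<Union>D \<inter> (P - {p}))" "Q = insert p (Q - {p})"
          using * B0(1) P(3) by auto
        then show ?thesis
          by (metis Diff_iff IntD2 insert_ident singletonI)
      next
        case False
        then have "\<Union>?D \<inter> P = \<Union>D \<inter> (P - {p})" "Q - {p} = Q"
          using * by auto
        then show ?thesis by simp
      qed
    qed
    have cr: "(\<forall>B\<in>?D. \<forall>C\<in>?V. \<not> crosses B C) \<longleftrightarrow>
        (\<forall>B\<in>D. \<forall>C\<in>V. \<not> crosses B C) \<and> p \<in> closable P Q"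
      if *: "\<forall>B\<in>V. \<not> B \<subseteq> P - {p}" "\<Union>D \<inter> (P - {p}) = Q - {p}"
    proof -
      \<comment> \<open>Since no block lies inside the open positions, every remaining block
        contains some \<open>j \<le> k\<close> and has at most one open end.\<close>
      have form: "\<exists>j p'. B = {j, p'} \<and> j \<le> k \<and> p' \<noteq> p \<and> p' \<noteq> Suc k \<and> j \<noteq> p'" if BV: "B \<in> V" for B
      proof -
        obtain j where j: "j \<in> B" "j \<notin> P - {p}" using *(1) BV by blast
        then have "j \<le> k" using V(2)[OF BV] by auto
        moreover obtain p' where "B = {j, p'}" "j \<noteq> p'"
          using V(3)[OF BV] j(1) by (auto simp: card_2_iff)
        ultimately show ?thesis using B[OF BV] B0 by blast
      qed
      have crp: "crosses B0 B \<longleftrightarrow> (\<exists>q\<in>B. q \<in> P \<and> q < p)" if BV: "B \<in> V" for B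
      proof -
        obtain j p' where j: "B = {j, p'}" "j \<le> k" "p' \<noteq> p" "p' \<noteq> Suc k" "j \<noteq> p'"
          using form[OF BV] by blast
        have "crosses B0 B \<longleftrightarrow> Suc k < p' \<and> p' < p"
          unfolding B0(1) using j p by (intro crosses_Suc_iff) auto
        moreover have "p' \<in> P" if "Suc k < p'"
          using that V(2)[OF BV] j by auto
        moreover have "j \<notin> P" "p' \<in> P \<Longrightarrow> Suc k < p'"
          using P(1) j(2) by auto
        ultimately show ?thesis using j(1) by auto
      qed
      \<comment> \<open>Every open position below \<open>p\<close> ends a block that crosses the new
        one, so a new block of the free colour needs \<open>p\<close> to be the lowest open
        position.\<close>
      have all: "(\<exists>B\<in>V. crosses B0 B) \<longleftrightarrow> (\<exists>q\<in>P. q < p)"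
      proof -
        have "q \<in> \<Union>V" if "q \<in> P" "q < p" for q using that V(1) by auto
        then show ?thesis using crp by blast
      qed
      \<comment> \<open>A bosonic new block conflicts only with free blocks, that is, with open
        positions in \<open>Q\<close> below \<open>p\<close>.\<close>
      have free: "(\<exists>B\<in>D. crosses B0 B) \<longleftrightarrow> (\<exists>q\<in>Q. q < p)"
      proof -
        have "q \<in> \<Union>D \<longleftrightarrow> q \<in> Q" if "q \<in> P" "q < p" for q using that *(2) by auto
        then show ?thesis using crp B0(3) P(2) by blast
      qed
      have comm: "crosses C B0 \<longleftrightarrow> crosses B0 C" for C
        by (rule crosses_commute)
      show ?thesis
      proof (cases "p \<in> Q")
        case True
        then have D: "?D = insert B0 D" by simp
        have "\<forall>B\<in>D. \<not> crosses B B0" if "\<forall>B\<in>V. \<not> crosses B0 B"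
          using B0(3) comm that by blast
        then have "(\<forall>B\<in>?D. \<forall>C\<in>?V. \<not> crosses B C) \<longleftrightarrow>
            (\<forall>B\<in>D. \<forall>C\<in>V. \<not> crosses B C) \<and> \<not> (\<exists>B\<in>V. crosses B0 B)"
          unfolding D using not_crosses_self[of B0] by auto
        moreover have "p \<in> closable P Q \<longleftrightarrow> \<not> (\<exists>q\<in>P. q < p)"
          using True P(3) by (auto simp: closable_def)
        ultimately show ?thesis using all by simp
      next
        case False
        then have D: "?D = D" by simp
        have "(\<forall>B\<in>?D. \<forall>C\<in>?V. \<not> crosses B C) \<longleftrightarrow>
            (\<forall>B\<in>D. \<forall>C\<in>V. \<not> crosses B C) \<and> \<not> (\<exists>B\<in>D. crosses B0 B)"
          unfolding D ball_simps comm by auto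
        moreover have "p \<in> closable P Q \<longleftrightarrow> \<not> (\<exists>q\<in>Q. q < p)"
          using False P(2,3) by (auto simp: closable_def)
        ultimately show ?thesis using free by simp
      qed
    qed
    have DV: "?D \<subseteq> ?V" using B0(3) by auto
    show ?thesis
    proof (cases "(\<forall>B\<in>V. \<not> B \<subseteq> P - {p}) \<and> \<Union>D \<inter> (P - {p}) = Q - {p}")
      case True
      show ?thesis
        unfolding open_pairings_def mem_Collect_eq case_prod_conv pp sub col
          cr[OF conjunct1[OF True] conjunct2[OF True]] using DV B0(3) by blast
    next
      case False
      then show ?thesis
        unfolding open_pairings_def mem_Collect_eq case_prod_conv pp sub col by blast
    qed
  qed
qed

text \<open>Splits by the partner of \<open>Suc k\<close>: still to be chosen, with either colour,
  or an open position \<open>p\<close>. The first two terms will match \<open>bos_up\<close> and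
  \<open>free_up\<close>, the last one \<open>bos_down\<close> and \<open>free_down\<close>.\<close>

lemma pairing_sum_Suc:
  assumes P: "P \<subseteq> {Suc k<..}" "Q \<subseteq> P" "finite P"
  shows "pairing_sum b f (Suc k) P Q =
    pairing_sum b f k (insert (Suc k) P) Q + pairing_sum b f k (insert (Suc k) P) (insert (Suc k) Q) +
    (\<Sum>p\<in>closable P Q. (if p \<in> Q then 1 - b else b) * inner (f (Suc k)) (f p) *
       pairing_sum b f k (P - {p}) (Q - {p}))"
proof -
  let ?O = "open_pairings (Suc k) P Q" and ?w = "pairing_weight b f"
  define C where "C p = {(V, D) \<in> ?O. {Suc k, p} \<in> V}" for p
  have fin: "finite ?O" by (rule finite_open_pairings) fact
  have Suc: "Suc k \<notin> P" "Suc k \<notin> Q" using P by auto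
  have disj: "C p \<inter> C q = {}" if "p \<in> P" "q \<in> P" "p \<noteq> q" for p q
  proof -
    have False if "pair_partition_on X V" "{Suc k, p} \<in> V" "{Suc k, q} \<in> V" for X V
    proof -
      have "{Suc k, p} \<noteq> {Suc k, q}" using \<open>p \<noteq> q\<close> by (simp add: doubleton_eq_iff)
      then show False using pair_partition_onD(4)[OF that] by simp
    qed
    then show ?thesis
      by (intro equals0I) (simp add: C_def open_pairings_def split_beta, metis)
  qed
  have sub: "open_pairings k (insert (Suc k) P) Q \<inter>
      open_pairings k (insert (Suc k) P) (insert (Suc k) Q) = {}"
    using Suc(2) by (auto simp: open_pairings_def)
  have "?O = {(V, D) \<in> ?O. \<forall>p\<in>P. {Suc k, p} \<notin> V} \<union> (\<Union>p\<in>P. C p)"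
    by (auto simp: C_def)
  then have "sum ?w ?O = sum ?w ({(V, D) \<in> ?O. \<forall>p\<in>P. {Suc k, p} \<notin> V} \<union> (\<Union>p\<in>P. C p))"
    by (rule arg_cong)
  also have "\<dots> = sum ?w {(V, D) \<in> ?O. \<forall>p\<in>P. {Suc k, p} \<notin> V} + sum ?w (\<Union>p\<in>P. C p)"
    using fin P(3) by (intro sum.union_disjoint) (auto simp: C_def intro: rev_finite_subset)
  also have "sum ?w {(V, D) \<in> ?O. \<forall>p\<in>P. {Suc k, p} \<notin> V} =
      pairing_sum b f k (insert (Suc k) P) Q + pairing_sum b f k (insert (Suc k) P) (insert (Suc k) Q)"
    unfolding open_pairings_insert[OF Suc(1) P(2)] pairing_sum_def
    using P(3) sub by (intro sum.union_disjoint finite_open_pairings) auto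
  also have "sum ?w (\<Union>p\<in>P. C p) = (\<Sum>p\<in>P. sum ?w (C p))"
    using fin P(3) disj by (intro sum.UNION_disjoint) (auto simp: C_def intro: rev_finite_subset)
  also have "\<dots> = (\<Sum>p\<in>P. if p \<in> closable P Q then (if p \<in> Q then 1 - b else b) *
      inner (f (Suc k)) (f p) * pairing_sum b f k (P - {p}) (Q - {p}) else 0)"
  proof (rule sum.cong)
    fix p assume p: "p \<in> P"
    let ?B = "{Suc k, p}"
    \<comment> \<open>\<open>g\<close> puts the removed block back; its colour is dictated by
      whether \<open>p\<close> is in \<open>Q\<close>.\<close>
    define g where "g = (\<lambda>(V, D). (insert ?B V, if p \<in> Q then insert ?B D else D))"
    have k: "Suc k < p" using p P by auto
    have notin: "?B \<notin> V" if "(V, D) \<in> open_pairings k (P - {p}) (Q - {p})" for V D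
      using that P k unfolding open_pairings_def by (auto dest!: pair_partition_onD(2))
    have img: "\<exists>V D. x = g (V, D) \<and> ?B \<notin> V \<and> D \<subseteq> V" if xC: "x \<in> C p" for x
    proof -
      obtain V D where x: "x = (V, D)" by (cases x)
      have "p \<in> Q \<longleftrightarrow> ?B \<in> D"
      proof
        assume "p \<in> Q"
        then obtain B where B: "B \<in> D" "p \<in> B" using xC p by (auto simp: C_def x open_pairings_def)
        then have "B = ?B"
          using xC pair_partition_onD(4)[of "{1..Suc k} \<union> P" V B ?B]
          by (auto simp: C_def x open_pairings_def)
        then show "?B \<in> D" using B by simp
      qed (use xC p in \<open>auto simp: C_def x open_pairings_def\<close>)
      then have "x = g (V - {?B}, D - {?B})"
        using xC by (auto simp: C_def x g_def)
      moreover have "D \<subseteq> V" using xC by (auto simp: C_def x open_pairings_def)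
      ultimately show ?thesis
        by (intro exI[of _ "V - {?B}"] exI[of _ "D - {?B}"]) auto
    qed
    have mem: "g (V, D) \<in> C p \<longleftrightarrow> p \<in> closable P Q \<and> (V, D) \<in> open_pairings k (P - {p}) (Q - {p})"
      if "?B \<notin> V" "D \<subseteq> V" for V D
      using open_pairings_close_iff[OF P(1,2) p refl that] by (simp add: C_def g_def)
    show "sum ?w (C p) = (if p \<in> closable P Q then (if p \<in> Q then 1 - b else b) *
      inner (f (Suc k)) (f p) * pairing_sum b f k (P - {p}) (Q - {p}) else 0)"
    proof (cases "p \<in> closable P Q")
      case False
      then have "C p = {}" using img mem by (metis equals0I)
      then show ?thesis using False by simp
    next
      case True
      let ?O' = "open_pairings k (P - {p}) (Q - {p})"
      have sub': "D \<subseteq> V" if "(V, D) \<in> ?O'" for V D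
        using that by (simp add: open_pairings_def)
      have "C p = g ` ?O'"
      proof
        show "C p \<subseteq> g ` ?O'" using img mem by (metis imageI subsetI)
        show "g ` ?O' \<subseteq> C p" using notin sub' mem True by auto
      qed
      moreover have "inj_on g ?O'"
      proof (rule inj_on_inverseI)
        fix x assume x: "x \<in> ?O'"
        obtain V D where "x = (V, D)" by (cases x)
        then show "(\<lambda>(V, D). (V - {?B}, D - {?B})) (g x) = x"
          using notin[of V D] sub'[of V D] x by (auto simp: g_def)
      qed
      ultimately have "sum ?w (C p) = (\<Sum>x\<in>?O'. ?w (g x))"
        by (simp add: sum.reindex)
      also have "\<dots> = (\<Sum>x\<in>?O'. (if p \<in> Q then 1 - b else b) * inner (f (Suc k)) (f p) * ?w x)"
      proof (rule sum.cong, simp, clarify)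
        fix V D assume VD: "(V, D) \<in> ?O'"
        then have "finite V"
          using pair_partition_on_finite[of "{1..k} \<union> (P - {p})" V] P(3) by (simp add: open_pairings_def)
        moreover have "?B \<notin> V" "?B \<notin> D" using notin[OF VD] sub'[OF VD] by auto
        moreover have "(\<Prod>B\<in>V. (if B \<in> (if p \<in> Q then insert ?B D else D) then 1 - b else b) *
             inner (f (Min B)) (f (Max B))) =
            (\<Prod>B\<in>V. (if B \<in> D then 1 - b else b) * inner (f (Min B)) (f (Max B)))"
          using \<open>?B \<notin> V\<close> by (intro prod.cong) auto
        ultimately show "?w (g (V, D)) =
            (if p \<in> Q then 1 - b else b) * inner (f (Suc k)) (f p) * ?w (V, D)"
          using k by (simp add: g_def pairing_weight_def)
      qed
      finally show ?thesis
        using True by (simp add: pairing_sum_def sum_distrib_left)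
    qed
  qed simp
  also have "\<dots> = (\<Sum>p\<in>closable P Q. (if p \<in> Q then 1 - b else b) * inner (f (Suc k)) (f p) *
       pairing_sum b f k (P - {p}) (Q - {p}))"
    using P(3) by (intro sum.mono_neutral_cong_right) (auto simp: closable_def)
  finally show ?thesis by (simp only: pairing_sum_def)
qed

lemma pairing_sum_0: "pairing_sum b f 0 P Q = (if P = {} \<and> Q = {} then 1 else 0)"
  by (simp add: pairing_sum_def open_pairings_0 pairing_weight_def)

text \<open>The position \<open>Suc k\<close> is the upper end of its block, so the sum is linear in \<open>f (Suc k)\<close>.\<close>

lemma pairing_sum_expand:
  fixes f :: "nat \<Rightarrow> 'h::real_inner"
  assumes "finite P" "P \<subseteq> {Suc k<..}" and f: "f (Suc k) = (\<Sum>e\<in>E. c e *\<^sub>R e)"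
  shows "pairing_sum b f k (insert (Suc k) P) Q =
    (\<Sum>e\<in>E. c e * pairing_sum b (f(Suc k := e)) k (insert (Suc k) P) Q)"
proof -
  let ?O = "open_pairings k (insert (Suc k) P) Q"
  have "pairing_weight b f x = (\<Sum>e\<in>E. c e * pairing_weight b (f(Suc k := e)) x)" if "x \<in> ?O" for x
  proof -
    obtain V D where x: "x = (V, D)" by (cases x)
    then have pp: "pair_partition_on ({1..k} \<union> insert (Suc k) P) V"
      and nP: "\<And>B. B \<in> V \<Longrightarrow> \<not> B \<subseteq> insert (Suc k) P"
      using that by (auto simp: open_pairings_def)
    note V = pair_partition_onD[OF pp]
    have fin: "finite V" using pp assms(1) by (auto intro: pair_partition_on_finite)
    obtain B where B: "B \<in> V" "Suc k \<in> B" using V(1) by blast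
    obtain j where j: "j \<in> B" "j \<notin> insert (Suc k) P" using nP[OF B(1)] by blast
    then have "j \<le> k" using V(2)[OF B(1)] by auto
    have "B = {j, Suc k}"
      using V(3)[OF B(1)] B(2) j by (auto simp: card_2_iff)
    then have m: "Min B = j" "Max B = Suc k" using \<open>j \<le> k\<close> by auto
    \<comment> \<open>All other blocks avoid \<open>Suc k\<close>, so a single factor of the weight
      depends on \<open>f (Suc k)\<close>.\<close>
    have other: "Min C \<noteq> Suc k" "Max C \<noteq> Suc k" if "C \<in> V - {B}" for C
    proof -
      have "finite C" "C \<noteq> {}" "Suc k \<notin> C"
        using that V(3,4)[of C] B by (auto intro: card_ge_0_finite)
      then show "Min C \<noteq> Suc k" "Max C \<noteq> Suc k" using Min_in Max_in by metis+
    qed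
    let ?r = "\<Prod>C\<in>V - {B}. (if C \<in> D then 1 - b else b) * inner (f (Min C)) (f (Max C))"
    have w: "pairing_weight b (f(Suc k := e)) x = (if B \<in> D then 1 - b else b) * inner (f j) e * ?r" for e
      unfolding pairing_weight_def x using B(1) fin m \<open>j \<le> k\<close> other
      by (simp add: prod.remove[of V B])
    have "pairing_weight b f x = pairing_weight b (f(Suc k := f (Suc k))) x" by simp
    also have "\<dots> = (\<Sum>e\<in>E. c e * pairing_weight b (f(Suc k := e)) x)"
      unfolding w f by (simp add: inner_sum_right sum_distrib_left sum_distrib_right mult_ac)
    finally show ?thesis .
  qed
  then show ?thesis
    unfolding pairing_sum_def by (simp add: sum_distrib_left) (rule sum.swap)
qed

text \<open>With no open positions, \<open>D\<close> ranges over all sets of blocks of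
  \<open>V\<close> that cross nothing, and \<open>power_H_eq_sum\<close> evaluates the inner
  sum.\<close>

lemma pairing_sum_eq_moment:
  "pairing_sum b f k {} {} =
     (\<Sum>V | pair_partition_on {1..k} V. b ^ H V * (\<Prod>B\<in>V. inner (f (Min B)) (f (Max B))))"
proof -
  let ?F = "\<lambda>V. {D. D \<subseteq> V \<and> (\<forall>B\<in>D. \<forall>C\<in>V. \<not> crosses B C)}"
  have nonempty: "B \<noteq> {}" if "pair_partition_on {1..k} V" "B \<in> V" for V B
    using pair_partition_onD(3)[OF that] by auto
  have eq: "open_pairings k {} {} = (SIGMA V:{V. pair_partition_on {1..k} V}. ?F V)"
    using nonempty by (auto simp: open_pairings_def)
  have fin: "finite V" if "pair_partition_on {1..k} V" for V
    using that by (rule pair_partition_on_finite) simp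
  have finP: "finite {V. pair_partition_on {1..k} V}"
    by (rule finite_subset[of _ "Pow (Pow {1..k})"]) (use pair_partition_onD(2) in blast, simp)
  have "pairing_sum b f k {} {} = (\<Sum>V | pair_partition_on {1..k} V. \<Sum>D\<in>?F V. pairing_weight b f (V, D))"
    unfolding pairing_sum_def eq using fin finP
    by (subst sum.Sigma) (auto intro: finite_subset[OF _ finite_Pow_iff[THEN iffD2]])
  also have "\<dots> = (\<Sum>V | pair_partition_on {1..k} V. b ^ H V * (\<Prod>B\<in>V. inner (f (Min B)) (f (Max B))))"
    by (intro sum.cong)
       (simp_all add: pairing_weight_def prod.distrib power_H_eq_sum[OF fin] sum_distrib_right)
  finally show ?thesis .
qed

section \<open>The Fock space\<close>

text \<open>
  An index \<open>(m, [(e\<^sub>1, m\<^sub>1), (e\<^sub>2, m\<^sub>2), \<dots>])\<close> stands for the product of the bosonic letters in \<open>m\<close>, the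
  free letter \<open>e\<^sub>1\<close>, the bosonic letters in \<open>m\<^sub>1\<close>, the free letter \<open>e\<^sub>2\<close>, and so on; the index stands for
  a normalized vector.
\<close>

type_synonym 'a fock_index = "'a multiset \<times> ('a \<times> 'a multiset) list"

text \<open>The operators act on coefficient functions: \<open>bos_up\<close> reads the coefficient
  at the index with one more letter and is thus the annihilator, while \<open>bos_down\<close> is
  the creator. The same holds for \<open>free_up\<close> and \<open>free_down\<close>.\<close>

definition bos_up :: "'a \<Rightarrow> ('a fock_index \<Rightarrow> real) \<Rightarrow> 'a fock_index \<Rightarrow> real" where
  "bos_up e a = (\<lambda>(m, l). sqrt (real (count m e) + 1) * a (add_mset e m, l))"

definition bos_down :: "'a \<Rightarrow> ('a fock_index \<Rightarrow> real) \<Rightarrow> 'a fock_index \<Rightarrow> real" where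
  "bos_down e a = (\<lambda>(m, l). sqrt (real (count m e)) * a (m - {#e#}, l))"

definition free_up :: "'a \<Rightarrow> ('a fock_index \<Rightarrow> real) \<Rightarrow> 'a fock_index \<Rightarrow> real" where
  "free_up e a = (\<lambda>(m, l). a ({#}, (e, m) # l))"

definition free_down :: "'a \<Rightarrow> ('a fock_index \<Rightarrow> real) \<Rightarrow> 'a fock_index \<Rightarrow> real" where
  "free_down e a = (\<lambda>(m, l). if m = {#} then
     (case l of [] \<Rightarrow> 0 | (e', m') # l' \<Rightarrow> if e' = e then a (m', l') else 0) else 0)"

section \<open>Finitely supported vectors and adjoints\<close>

definition finite_support :: "('a \<Rightarrow> real) \<Rightarrow> bool" where
  "finite_support a \<longleftrightarrow> finite {z. a z \<noteq> 0}"

text \<open>The sum over all indices is \<open>Sum_any\<close>, which is \<open>0\<close> if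
  infinitely many terms are nonzero; additivity is therefore proved for finitely supported
  vectors.\<close>

definition fock_inner :: "('a \<Rightarrow> real) \<Rightarrow> ('a \<Rightarrow> real) \<Rightarrow> real" where
  "fock_inner a c = (\<Sum>z. a z * c z)"

lemma finite_supportI: "finite_support a \<Longrightarrow> {z. c z \<noteq> 0} \<subseteq> g ` {z. a z \<noteq> 0} \<Longrightarrow> finite_support c"
  unfolding finite_support_def by (blast intro: finite_subset)

lemma finite_support_bos_up: "finite_support a \<Longrightarrow> finite_support (bos_up e a)"
  by (erule finite_supportI[where g = "\<lambda>(m, l). (m - {#e#}, l)"]) (force simp: bos_up_def image_iff)

lemma finite_support_bos_down: "finite_support a \<Longrightarrow> finite_support (bos_down e a)"
proof (erule finite_supportI[where g = "\<lambda>(m, l). (add_mset e m, l)"], clarify)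
  fix m and l :: "('a \<times> 'a multiset) list" assume "bos_down e a (m, l) \<noteq> 0"
  \<comment> \<open>The factor \<open>sqrt (real (count m e))\<close> vanishes when \<open>e\<close>
    is not in \<open>m\<close>, so the truncation in \<open>m - {#e#}\<close> does no harm.\<close>
  then have "a (m - {#e#}, l) \<noteq> 0" "e \<in># m" by (auto simp: bos_down_def)
  then show "(m, l) \<in> (\<lambda>(m, l). (add_mset e m, l)) ` {z. a z \<noteq> 0}"
    by (intro image_eqI[of _ _ "(m - {#e#}, l)"]) auto
qed

lemma finite_support_free_up: "finite_support a \<Longrightarrow> finite_support (free_up e a)"
  by (erule finite_supportI[where g = "\<lambda>(m, l). (snd (hd l), tl l)"]) (force simp: free_up_def image_iff)

lemma finite_support_free_down: "finite_support a \<Longrightarrow> finite_support (free_down e a)"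
  by (erule finite_supportI[where g = "\<lambda>(m, l). ({#}, (e, m) # l)"])
     (force simp: free_down_def image_iff split: if_splits list.splits)

text \<open>Shifting the index by one letter matches the nonzero terms of both sums, and the factor
  of \<open>bos_up\<close> at \<open>m\<close> equals that of \<open>bos_down\<close> at
  \<open>add_mset e m\<close>.\<close>

lemma fock_inner_bos: "fock_inner (bos_up e a) c = fock_inner a (bos_down e c)"
  unfolding fock_inner_def Sum_any.expand_set
  by (rule sum.reindex_bij_witness[where i = "\<lambda>(m, l). (m - {#e#}, l)"
        and j = "\<lambda>(m, l). (add_mset e m, l)"])
     (auto simp: bos_up_def bos_down_def count_eq_zero_iff)

lemma fock_inner_free: "fock_inner (free_up e a) c = fock_inner a (free_down e c)"
  unfolding fock_inner_def Sum_any.expand_set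
  by (rule sum.reindex_bij_witness[where i = "\<lambda>(m, l). (snd (hd l), tl l)"
        and j = "\<lambda>(m, l). ({#}, (e, m) # l)"])
     (auto simp: free_up_def free_down_def split: if_splits list.splits)

lemma fock_inner_commute: "fock_inner a c = fock_inner c a"
  by (simp add: fock_inner_def mult.commute)

lemma fock_inner_superset:
  assumes "finite Z" "{z. a z \<noteq> 0} \<subseteq> Z"
  shows "fock_inner a c = (\<Sum>z\<in>Z. a z * c z)"
  unfolding fock_inner_def using assms by (intro Sum_any.expand_superset) auto

lemma finite_support_add:
  "finite_support a \<Longrightarrow> finite_support c \<Longrightarrow> finite_support (\<lambda>z. a z + c z)"
  unfolding finite_support_def
  by (rule finite_subset[of _ "{z. a z \<noteq> 0} \<union> {z. c z \<noteq> 0}"]) auto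

lemma finite_support_scale: "finite_support a \<Longrightarrow> finite_support (\<lambda>z. r * a z)"
  unfolding finite_support_def by (rule finite_subset[of _ "{z. a z \<noteq> 0}"]) auto

lemma finite_support_sum:
  "(\<And>i. i \<in> I \<Longrightarrow> finite_support (a i)) \<Longrightarrow> finite_support (\<lambda>z. \<Sum>i\<in>I. a i z)"
  by (induction I rule: infinite_finite_induct)
     (auto simp: finite_support_add, auto simp: finite_support_def)

lemma fock_inner_add:
  assumes "finite_support a" "finite_support a'"
  shows "fock_inner (\<lambda>z. a z + a' z) c = fock_inner a c + fock_inner a' c"
proof -
  let ?Z = "{z. a z \<noteq> 0} \<union> {z. a' z \<noteq> 0}"
  have "finite ?Z" using assms by (simp add: finite_support_def)
  then have "fock_inner (\<lambda>z. a z + a' z) c = (\<Sum>z\<in>?Z. (a z + a' z) * c z)"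
    "fock_inner a c = (\<Sum>z\<in>?Z. a z * c z)" "fock_inner a' c = (\<Sum>z\<in>?Z. a' z * c z)"
    by (auto intro!: fock_inner_superset)
  then show ?thesis by (simp add: distrib_right sum.distrib)
qed

lemma fock_inner_scale:
  assumes "finite_support a"
  shows "fock_inner (\<lambda>z. r * a z) c = r * fock_inner a c"
  using assms
  by (subst (1 2) fock_inner_superset[of "{z. a z \<noteq> 0}"])
     (auto simp: finite_support_def sum_distrib_left mult.assoc)

lemma fock_inner_sum:
  "(\<And>i. i \<in> I \<Longrightarrow> finite_support (a i)) \<Longrightarrow>
     fock_inner (\<lambda>z. \<Sum>i\<in>I. a i z) c = (\<Sum>i\<in>I. fock_inner (a i) c)"
  by (induction I rule: infinite_finite_induct)
     (simp_all add: fock_inner_add finite_support_sum, simp_all add: fock_inner_def)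

section \<open>Symmetric field operators and their words\<close>

definition fock_letter :: "real \<Rightarrow> 'a \<Rightarrow> ('a fock_index \<Rightarrow> real) \<Rightarrow> 'a fock_index \<Rightarrow> real" where
  "fock_letter b e a = (\<lambda>z. sqrt b * (bos_up e a z + bos_down e a z) +
     sqrt (1 - b) * (free_up e a z + free_down e a z))"

text \<open>\<open>E\<close> will be a finite orthonormal set whose span contains all vectors of the
  words at hand.\<close>

definition fock_field ::
  "real \<Rightarrow> 'h::real_inner set \<Rightarrow> 'h \<Rightarrow> ('h fock_index \<Rightarrow> real) \<Rightarrow> 'h fock_index \<Rightarrow> real" where
  "fock_field b E f a = (\<lambda>z. \<Sum>e\<in>E. inner f e * fock_letter b e a z)"

definition fock_vacuum :: "'a fock_index \<Rightarrow> real" where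
  "fock_vacuum z = (if z = ({#}, []) then 1 else 0)"

definition fock_word :: "real \<Rightarrow> 'h::real_inner set \<Rightarrow> 'h list \<Rightarrow> 'h fock_index \<Rightarrow> real" where
  "fock_word b E w = foldr (fock_field b E) w fock_vacuum"

lemmas finite_support_intros = finite_support_bos_up finite_support_bos_down finite_support_free_up
  finite_support_free_down finite_support_add finite_support_scale finite_support_sum

lemma finite_support_fock_letter: "finite_support a \<Longrightarrow> finite_support (fock_letter b e a)"
  unfolding fock_letter_def by (intro finite_support_intros)

lemma finite_support_fock_field: "finite_support a \<Longrightarrow> finite_support (fock_field b E f a)"
  unfolding fock_field_def by (intro finite_support_intros finite_support_fock_letter)

lemma fock_inner_letter:
  assumes "finite_support a" "finite_support c"
  shows "fock_inner (fock_letter b e a) c = fock_inner a (fock_letter b e c)"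
proof -
  have *: "fock_inner (fock_letter b e a) c =
      sqrt b * (fock_inner (bos_up e a) c + fock_inner (bos_down e a) c) +
      sqrt (1 - b) * (fock_inner (free_up e a) c + fock_inner (free_down e a) c)"
    if "finite_support a" for a c :: "'a fock_index \<Rightarrow> real"
    unfolding fock_letter_def using that
    by (simp add: fock_inner_add fock_inner_scale finite_support_intros)
  have down: "fock_inner (bos_down e a) c = fock_inner a (bos_up e c)"
    "fock_inner (free_down e a) c = fock_inner a (free_up e c)" for a c :: "'a fock_index \<Rightarrow> real"
    by (metis fock_inner_bos fock_inner_commute, metis fock_inner_free fock_inner_commute)
  show ?thesis
    unfolding *[OF assms(1)] fock_inner_commute[of a "fock_letter b e c"] *[OF assms(2)]
      fock_inner_bos fock_inner_free down
    by (simp add: fock_inner_commute[of c] add.commute fock_inner_bos fock_inner_free down)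
qed

lemma fock_inner_field:
  assumes "finite_support a" "finite_support c"
  shows "fock_inner (fock_field b E f a) c = fock_inner a (fock_field b E f c)"
proof -
  have *: "fock_inner (fock_field b E f a) c = (\<Sum>e\<in>E. inner f e * fock_inner (fock_letter b e a) c)"
    if "finite_support a" for a c :: "'a fock_index \<Rightarrow> real"
    unfolding fock_field_def using that
    by (simp add: fock_inner_sum fock_inner_scale finite_support_intros finite_support_fock_letter)
  show ?thesis
    using assms by (simp add: * fock_inner_letter fock_inner_commute[of a])
qed

lemma finite_support_foldr: "finite_support a \<Longrightarrow> finite_support (foldr (fock_field b E) w a)"
  by (induction w) (simp_all add: finite_support_fock_field)

lemma finite_support_vacuum: "finite_support fock_vacuum"
  unfolding finite_support_def fock_vacuum_def by (rule finite_subset[of _ "{({#}, [])}"]) auto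

lemma fock_inner_foldr:
  assumes "finite_support a" "finite_support c"
  shows "fock_inner (foldr (fock_field b E) w a) c = fock_inner a (foldr (fock_field b E) (rev w) c)"
  using assms
  by (induction w arbitrary: c)
     (simp_all add: fock_inner_field finite_support_foldr finite_support_fock_field)

lemma fock_inner_vacuum: "fock_inner fock_vacuum c = c ({#}, [])"
  by (subst fock_inner_superset[of "{({#}, [])}"]) (auto simp: fock_vacuum_def)

text \<open>Symmetry moves the field operators of \<open>v\<close> to the other side in reverse
  order, leaving the vacuum in the first argument.\<close>

lemma fock_inner_word:
  "fock_inner (fock_word b E v) (fock_word b E u) = fock_word b E (rev v @ u) ({#}, [])"
  unfolding fock_word_def
  by (simp add: fock_inner_foldr finite_support_foldr finite_support_vacuum fock_inner_vacuum)

lemma finite_support_word: "finite_support (fock_word b E w)"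
  unfolding fock_word_def by (intro finite_support_foldr finite_support_vacuum)

text \<open>The index of a set of open positions listed in increasing order: positions in
  \<open>Q\<close> give free letters, the others bosonic ones. Between free letters the order is
  forgotten, since bosonic creators commute.\<close>

fun fock_code :: "nat set \<Rightarrow> (nat \<Rightarrow> 'a) \<Rightarrow> nat list \<Rightarrow> 'a fock_index" where
  "fock_code Q f [] = ({#}, [])"
| "fock_code Q f (p # s) = (case fock_code Q f s of (m, l) \<Rightarrow>
     if p \<in> Q then ({#}, (f p, m) # l) else (add_mset (f p) m, l))"

lemma fock_code_cong:
  assumes "\<And>p. p \<in> set s \<Longrightarrow> (p \<in> Q \<longleftrightarrow> p \<in> Q') \<and> f p = f' p"
  shows "fock_code Q f s = fock_code Q' f' s"
  using assms by (induction s) (auto split: prod.splits)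

lemma set_mset_fock_code: "set_mset (fst (fock_code Q f s)) \<subseteq> f ` set s"
  by (induction s) (auto split: prod.splits)

text \<open>With \<open>fock_norm\<close>, the conversion factor from Fock coefficients to pairing
  sums. An open block enters a pairing sum with its full weight but a word with one square root
  only; the factorials undo the normalization of the basis vectors.\<close>

definition bos_norm :: "real \<Rightarrow> 'a set \<Rightarrow> 'a multiset \<Rightarrow> real" where
  "bos_norm b E m = sqrt b ^ size m * (\<Prod>e\<in>E. sqrt (fact (count m e)))"

definition fock_norm :: "real \<Rightarrow> 'a set \<Rightarrow> 'a fock_index \<Rightarrow> real" where
  "fock_norm b E = (\<lambda>(m, l). bos_norm b E m * (\<Prod>(e, m')\<leftarrow>l. sqrt (1 - b) * bos_norm b E m'))"

lemma bos_norm_add_mset: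
  assumes "finite E" "e \<in> E"
  shows "bos_norm b E (add_mset e m) = sqrt b * sqrt (real (count m e) + 1) * bos_norm b E m"
proof -
  have "(\<Prod>x\<in>E - {e}. sqrt (fact (count (add_mset e m) x))) = (\<Prod>x\<in>E - {e}. sqrt (fact (count m x)))"
    by (intro prod.cong) auto
  then show ?thesis
    using assms by (simp add: bos_norm_def prod.remove[of E e] real_sqrt_mult add.commute)
qed

lemma fock_norm_add_mset:
  assumes "finite E" "e \<in> E"
  shows "fock_norm b E (add_mset e m, l) = sqrt b * sqrt (real (count m e) + 1) * fock_norm b E (m, l)"
  using assms by (simp add: fock_norm_def bos_norm_add_mset)

lemma fock_norm_push: "fock_norm b E ({#}, (e, m) # l) = sqrt (1 - b) * fock_norm b E (m, l)"
  by (simp add: fock_norm_def bos_norm_def)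

lemma sum_count_mult:
  fixes F :: "'a \<Rightarrow> real"
  assumes "finite E" "set_mset m \<subseteq> E"
  shows "(\<Sum>e\<in>E. real (count m e) * F e) = (\<Sum>e\<in>#m. F e)"
  using assms(2)
proof (induction m)
  case (add x m)
  have "(\<Sum>e\<in>E. real (count (add_mset x m) e) * F e) =
      (\<Sum>e\<in>E. real (count m e) * F e + (if e = x then F e else 0))"
    by (intro sum.cong) (auto simp: algebra_simps)
  then show ?case
    using add assms(1) by (simp add: sum.distrib)
qed simp

text \<open>A position outside \<open>Q\<close> is closable exactly when no open free position
  precedes it, so these positions are the occurrences in the leading multiset
  \<open>m\<close>.\<close>

lemma sum_closable_bos:
  fixes h :: "'a \<Rightarrow> real"
  assumes "sorted_wrt (<) s" and "fock_code Q f s = (m, l)"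
  shows "(\<Sum>p\<in>closable (set s) Q - Q. h (f p) * g (fock_code Q f (remove1 p s))) =
    (\<Sum>e\<in>#m. h e * g (m - {#e#}, l))"
  using assms
proof (induction s arbitrary: m l g)
  case Nil
  then show ?case by (simp add: closable_def)
next
  case (Cons p s)
  obtain m' l' where s: "fock_code Q f s = (m', l')" by fastforce
  have lt: "\<And>q. q \<in> set s \<Longrightarrow> p < q" and sorted: "sorted_wrt (<) s" using Cons.prems(1) by auto
  show ?case
  proof (cases "p \<in> Q")
    case True
    then have eq: "closable (set (p # s)) Q - Q = {}"
      using lt by (auto simp: closable_def)
    have "m = {#}" using True Cons.prems(2) s by auto
    then show ?thesis unfolding eq by simp
  next
    case False
    have m: "m = add_mset (f p) m'" "l = l'" using False Cons.prems(2) s by auto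
    have eq: "closable (set (p # s)) Q - Q = insert p (closable (set s) Q - Q)"
      using lt False by (fastforce simp: closable_def)
    have p: "p \<notin> closable (set s) Q - Q" using lt by (auto simp: closable_def)
    have fin: "finite (closable (set s) Q - Q)" by (auto simp: closable_def)
    \<comment> \<open>Absorbing the head letter into \<open>g\<close> reduces to the tail; this is
      why \<open>g\<close> is generalized in the induction.\<close>
    let ?g = "\<lambda>(m, l). g (add_mset (f p) m, l)"
    have "(\<Sum>q\<in>closable (set s) Q - Q. h (f q) * g (fock_code Q f (remove1 q (p # s)))) =
        (\<Sum>q\<in>closable (set s) Q - Q. h (f q) * ?g (fock_code Q f (remove1 q s)))"
      using False p by (intro sum.cong) (auto split: prod.splits)
    also have "\<dots> = (\<Sum>e\<in>#m'. h e * g (add_mset (f p) (m' - {#e#}), l'))"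
      using Cons.IH[OF sorted s, of ?g] by simp
    also have "\<dots> = (\<Sum>e\<in>#m'. h e * g (m - {#e#}, l))"
      by (intro arg_cong[where f = sum_mset] image_mset_cong) (simp add: m)
    finally show ?thesis
      unfolding eq using p fin s m by simp
  qed
qed

text \<open>A free position is closable only as the lowest open position, the head of
  \<open>s\<close>, so the sum has at most one term.\<close>

lemma sum_closable_free:
  fixes h :: "'a \<Rightarrow> real"
  assumes "sorted_wrt (<) s" and "fock_code Q f s = (m, l)"
  shows "(\<Sum>p\<in>closable (set s) Q \<inter> Q. h (f p) * g (fock_code (Q - {p}) f (remove1 p s))) =
    (if m = {#} then case l of [] \<Rightarrow> 0 | (e, m') # l' \<Rightarrow> h e * g (m', l') else 0)"
proof (cases s)
  case Nil
  then show ?thesis using assms by (simp add: closable_def)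
next
  case (Cons p s')
  have lt: "\<And>q. q \<in> set s' \<Longrightarrow> p < q" using assms(1) Cons by auto
  have sub: "closable (set s) Q \<inter> Q = (if p \<in> Q then {p} else {})"
    using lt less_asym[OF lt] by (cases "p \<in> Q") (auto simp: closable_def Cons)
  have "fock_code (Q - {p}) f s' = fock_code Q f s'"
    using lt by (intro fock_code_cong) auto
  moreover obtain m' l' where "fock_code Q f s' = (m', l')" by fastforce
  ultimately show ?thesis
    unfolding sub using assms(2) Cons by (cases "p \<in> Q") auto
qed

text \<open>Both sides obey the same recursion in \<open>k\<close>: opening \<open>Suc k\<close>
  matches the up operators, closing an open position the down operators. Letters of an index must
  lie in \<open>E\<close>, so the vector at a newly opened position is first expanded in
  \<open>E\<close>; hence \<open>f\<close> varies in the induction.\<close>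

lemma pairing_sum_eq_fock_word:
  fixes f :: "nat \<Rightarrow> 'h::real_inner"
  assumes b: "0 \<le> b" "b \<le> 1" and E: "finite E"
    and "sorted_wrt (<) s" "set s \<subseteq> {k<..}" "Q \<subseteq> set s" "f ` set s \<subseteq> E"
    and "\<And>i. i \<in> {1..k} \<Longrightarrow> f i = (\<Sum>e\<in>E. inner (f i) e *\<^sub>R e)"
  shows "pairing_sum b f k (set s) Q =
    fock_norm b E (fock_code Q f s) * fock_word b E (map f (rev [1..<Suc k])) (fock_code Q f s)"
  using assms(4-)
proof (induction k arbitrary: s Q f)
  case 0
  have "fock_code Q f s = ({#}, []) \<longleftrightarrow> s = []"
    by (cases s) (auto split: prod.splits)
  then show ?case
    using 0 by (auto simp: pairing_sum_0 fock_word_def fock_vacuum_def fock_norm_def bos_norm_def)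
next
  case (Suc k)
  note upt_Suc [simp del]
  let ?w = "map f (rev [1..<Suc k])"
  let ?v = "fock_word b E ?w" and ?c = "\<lambda>e. inner (f (Suc k)) e" and ?N = "fock_norm b E"
  obtain m l where ml: "fock_code Q f s = (m, l)" by fastforce
  have notin: "Suc k \<notin> set s" "Suc k \<notin> Q" using Suc.prems by auto
  have sets: "set s \<subseteq> {Suc k<..}" using Suc.prems(2) by auto
  have P: "pairing_sum b f k (insert (Suc k) (set s)) Q' =
      (\<Sum>e\<in>E. ?c e * (?N (fock_code Q' (f(Suc k := e)) (Suc k # s)) *
         ?v (fock_code Q' (f(Suc k := e)) (Suc k # s))))" if "Q' \<subseteq> insert (Suc k) (set s)" for Q'
  proof -
    have "pairing_sum b (f(Suc k := e)) k (insert (Suc k) (set s)) Q' =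
      ?N (fock_code Q' (f(Suc k := e)) (Suc k # s)) * ?v (fock_code Q' (f(Suc k := e)) (Suc k # s))"
      if e: "e \<in> E" for e
    proof -
      let ?f = "f(Suc k := e)"
      have "pairing_sum b ?f k (set (Suc k # s)) Q' =
          ?N (fock_code Q' ?f (Suc k # s)) *
          fock_word b E (map ?f (rev [1..<Suc k])) (fock_code Q' ?f (Suc k # s))"
        using Suc.prems sets notin e \<open>Q' \<subseteq> insert (Suc k) (set s)\<close>
        by (intro Suc.IH) (auto simp: image_subset_iff)
      \<comment> \<open>\<open>?f\<close> differs from \<open>f\<close> only at
        \<open>Suc k\<close>, which lies outside \<open>[1..<Suc k]\<close>.\<close>
      moreover have "map ?f (rev [1..<Suc k]) = ?w" by simp
      ultimately show ?thesis by simp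
    qed
    moreover have "pairing_sum b f k (insert (Suc k) (set s)) Q' =
        (\<Sum>e\<in>E. ?c e * pairing_sum b (f(Suc k := e)) k (insert (Suc k) (set s)) Q')"
      using sets Suc.prems(5)[of "Suc k"] by (intro pairing_sum_expand) auto
    ultimately show ?thesis by simp
  qed
  have code: "fock_code Q (f(Suc k := e)) (Suc k # s) = (add_mset e m, l)"
    "fock_code (insert (Suc k) Q) (f(Suc k := e)) (Suc k # s) = ({#}, (e, m) # l)" for e
  proof -
    have "fock_code Q (f(Suc k := e)) s = (m, l)" "fock_code (insert (Suc k) Q) (f(Suc k := e)) s = (m, l)"
      unfolding ml[symmetric] using notin by (auto intro!: fock_code_cong)
    then show "fock_code Q (f(Suc k := e)) (Suc k # s) = (add_mset e m, l)"
      "fock_code (insert (Suc k) Q) (f(Suc k := e)) (Suc k # s) = ({#}, (e, m) # l)"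
      using notin by simp_all
  qed
  have up: "pairing_sum b f k (insert (Suc k) (set s)) Q =
      ?N (m, l) * (\<Sum>e\<in>E. ?c e * (sqrt b * bos_up e ?v (m, l)))"
    "pairing_sum b f k (insert (Suc k) (set s)) (insert (Suc k) Q) =
      ?N (m, l) * (\<Sum>e\<in>E. ?c e * (sqrt (1 - b) * free_up e ?v (m, l)))"
  proof -
    show "pairing_sum b f k (insert (Suc k) (set s)) Q =
        ?N (m, l) * (\<Sum>e\<in>E. ?c e * (sqrt b * bos_up e ?v (m, l)))"
    proof -
      have "pairing_sum b f k (insert (Suc k) (set s)) Q =
          (\<Sum>e\<in>E. ?c e * (?N (add_mset e m, l) * ?v (add_mset e m, l)))"
        using P[of Q] Suc.prems(3) unfolding code by blast
      then show ?thesis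
        by (simp add: fock_norm_add_mset[OF E] bos_up_def sum_distrib_left mult_ac)
    qed
    show "pairing_sum b f k (insert (Suc k) (set s)) (insert (Suc k) Q) =
        ?N (m, l) * (\<Sum>e\<in>E. ?c e * (sqrt (1 - b) * free_up e ?v (m, l)))"
    proof -
      have "pairing_sum b f k (insert (Suc k) (set s)) (insert (Suc k) Q) =
          (\<Sum>e\<in>E. ?c e * (?N ({#}, (e, m) # l) * ?v ({#}, (e, m) # l)))"
        using P[of "insert (Suc k) Q"] Suc.prems(3) unfolding code by blast
      then show ?thesis
        by (simp add: fock_norm_push free_up_def sum_distrib_left mult_ac)
    qed
  qed
  let ?g = "\<lambda>z. ?N z * ?v z"
  have IH: "pairing_sum b f k (set s - {p}) (Q - {p}) = ?g (fock_code (Q - {p}) f (remove1 p s))"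
    if "p \<in> set s" for p
  proof -
    have "distinct s" using Suc.prems(1) by (simp add: strict_sorted_iff)
    then have "set (remove1 p s) = set s - {p}" by simp
    moreover have "sorted_wrt (<) (remove1 p s)"
      using Suc.prems(1) by (metis sorted_remove1 strict_sorted_iff distinct_remove1)
    ultimately show ?thesis
      using Suc.prems sets by (subst Suc.IH[symmetric]) auto
  qed
  have down_bos: "(\<Sum>p\<in>closable (set s) Q - Q. ?c (f p) * pairing_sum b f k (set s - {p}) (Q - {p})) * b =
      ?N (m, l) * (\<Sum>e\<in>E. ?c e * (sqrt b * bos_down e ?v (m, l)))"
  proof -
    have mE: "set_mset m \<subseteq> E"
      using set_mset_fock_code[of Q f s] ml Suc.prems(4) by auto
    have "(\<Sum>p\<in>closable (set s) Q - Q. ?c (f p) * pairing_sum b f k (set s - {p}) (Q - {p})) =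
        (\<Sum>p\<in>closable (set s) Q - Q. ?c (f p) * ?g (fock_code Q f (remove1 p s)))"
    proof (rule sum.cong)
      fix p assume "p \<in> closable (set s) Q - Q"
      then have "p \<in> set s" "Q - {p} = Q" by (auto simp: closable_def)
      then show "?c (f p) * pairing_sum b f k (set s - {p}) (Q - {p}) =
          ?c (f p) * ?g (fock_code Q f (remove1 p s))"
        using IH by metis
    qed simp
    also have "\<dots> = (\<Sum>e\<in>#m. ?c e * ?g (m - {#e#}, l))"
      by (rule sum_closable_bos[OF Suc.prems(1) ml])
    also have "\<dots> = (\<Sum>e\<in>E. real (count m e) * (?c e * ?g (m - {#e#}, l)))"
      by (rule sum_count_mult[OF E mE, symmetric])
    finally have *: "(\<Sum>p\<in>closable (set s) Q - Q. ?c (f p) * pairing_sum b f k (set s - {p}) (Q - {p})) * b =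
        (\<Sum>e\<in>E. real (count m e) * (?c e * ?g (m - {#e#}, l)) * b)"
      by (simp add: sum_distrib_right)
    \<comment> \<open>One square root of the multiplicity \<open>count m e\<close>, like one of
      \<open>b\<close>, goes into \<open>fock_norm\<close> and the other into
      \<open>bos_down\<close>.\<close>
    have "real (count m e) * (?c e * ?g (m - {#e#}, l)) * b =
        ?N (m, l) * (?c e * (sqrt b * bos_down e ?v (m, l)))" if e: "e \<in> E" for e
    proof (cases "e \<in># m")
      case False
      then have "count m e = 0" by (simp add: count_eq_zero_iff)
      then show ?thesis by (simp add: bos_down_def)
    next
      case True
      then obtain m' where m: "m = add_mset e m'" by (metis multi_member_split)
      have "sqrt b * sqrt b = b"
        "sqrt (real (count m' e) + 1) * sqrt (real (count m' e) + 1) = real (count m' e) + 1"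
        using b by simp_all
      then have "real (count m e) * b =
          sqrt b * sqrt (real (count m' e) + 1) * (sqrt b * sqrt (real (count m e)))"
        by (simp add: m add.commute mult_ac)
      then show ?thesis
        using e E by (simp add: m fock_norm_add_mset bos_down_def mult_ac add.commute)
    qed
    then show ?thesis unfolding * sum_distrib_left by (rule sum.cong[OF refl])
  qed
  have down_free: "(\<Sum>p\<in>closable (set s) Q \<inter> Q. ?c (f p) * pairing_sum b f k (set s - {p}) (Q - {p})) * (1 - b) =
      ?N (m, l) * (\<Sum>e\<in>E. ?c e * (sqrt (1 - b) * free_down e ?v (m, l)))"
  proof -
    have "(\<Sum>p\<in>closable (set s) Q \<inter> Q. ?c (f p) * pairing_sum b f k (set s - {p}) (Q - {p})) =
        (\<Sum>p\<in>closable (set s) Q \<inter> Q. ?c (f p) * ?g (fock_code (Q - {p}) f (remove1 p s)))"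
      by (intro sum.cong) (auto simp: IH closable_def)
    also have "\<dots> = (if m = {#} then case l of [] \<Rightarrow> 0 | (e, m') # l' \<Rightarrow> ?c e * ?g (m', l') else 0)"
      by (rule sum_closable_free[OF Suc.prems(1) ml])
    finally have *: "(\<Sum>p\<in>closable (set s) Q \<inter> Q. ?c (f p) * pairing_sum b f k (set s - {p}) (Q - {p})) = \<dots>" .
    show ?thesis
    proof (cases "m = {#} \<and> l \<noteq> []")
      case False
      then show ?thesis unfolding * by (auto simp: free_down_def)
    next
      case True
      then obtain e m' l' where l: "m = {#}" "l = (e, m') # l'" by (metis list.exhaust surj_pair)
      have e: "e \<in> E"
        using ml l Suc.prems(4) by (cases s) (auto split: prod.splits if_splits)
      have "(\<Sum>x\<in>E. ?c x * (sqrt (1 - b) * free_down x ?v (m, l))) =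
          (\<Sum>x\<in>E. if x = e then ?c e * (sqrt (1 - b) * ?v (m', l')) else 0)"
        by (intro sum.cong) (auto simp: free_down_def l)
      also have "\<dots> = ?c e * (sqrt (1 - b) * ?v (m', l'))"
        using e E by simp
      finally have "?N (m, l) * (\<Sum>x\<in>E. ?c x * (sqrt (1 - b) * free_down x ?v (m, l))) =
          (sqrt (1 - b) * sqrt (1 - b)) * (?c e * ?g (m', l'))"
        by (simp add: l fock_norm_push mult_ac)
      then show ?thesis
        unfolding * using b by (simp add: l mult_ac)
    qed
  qed
  have fin: "finite (closable (set s) Q)" by (auto simp: closable_def)
  let ?S = "\<lambda>p. (if p \<in> Q then 1 - b else b) * ?c (f p) * pairing_sum b f k (set s - {p}) (Q - {p})"
  have "sum ?S (closable (set s) Q) = sum ?S (closable (set s) Q - Q) + sum ?S (closable (set s) Q \<inter> Q)"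
    by (subst sum.Int_Diff[OF fin, of _ Q]) (rule add.commute)
  also have "sum ?S (closable (set s) Q - Q) =
      (\<Sum>p\<in>closable (set s) Q - Q. ?c (f p) * pairing_sum b f k (set s - {p}) (Q - {p})) * b"
    unfolding sum_distrib_right by (intro sum.cong refl) (simp add: mult_ac)
  also have "sum ?S (closable (set s) Q \<inter> Q) =
      (\<Sum>p\<in>closable (set s) Q \<inter> Q. ?c (f p) * pairing_sum b f k (set s - {p}) (Q - {p})) * (1 - b)"
    unfolding sum_distrib_right by (intro sum.cong refl) (simp add: mult_ac)
  finally have close: "sum ?S (closable (set s) Q) =
      ?N (m, l) * (\<Sum>e\<in>E. ?c e * (sqrt b * bos_down e ?v (m, l))) +
      ?N (m, l) * (\<Sum>e\<in>E. ?c e * (sqrt (1 - b) * free_down e ?v (m, l)))"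
    unfolding down_bos down_free .
  have "pairing_sum b f (Suc k) (set s) Q = ?N (m, l) * fock_field b E (f (Suc k)) ?v (m, l)"
    using Suc.prems(3)
    by (simp add: pairing_sum_Suc[OF sets] up close fock_field_def fock_letter_def
        distrib_left sum.distrib)
  moreover have "fock_word b E (map f (rev [1..<Suc (Suc k)])) = fock_field b E (f (Suc k)) ?v"
    by (simp add: fock_word_def upt_Suc)
  ultimately show ?case by (simp only: ml)
qed

text \<open>Orthogonalize \<open>F\<close>, discard \<open>0\<close> and normalize; orthogonality
  identifies the coefficients of the expansion.\<close>

lemma finite_orthonormal_expansion:
  fixes F :: "'h::real_inner set"
  assumes "finite F"
  obtains E where "finite E" "\<And>f. f \<in> F \<Longrightarrow> f = (\<Sum>e\<in>E. inner f e *\<^sub>R e)"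
proof -
  obtain C where C: "finite C" "span C = span F" "pairwise orthogonal C"
    using basis_orthogonal[OF assms] by blast
  define E where "E = C - {0}"
  have E: "finite E" "span E = span F" using C by (simp_all add: E_def)
  have orth: "inner x y = 0" if "x \<in> E" "y \<in> E" "x \<noteq> y" for x y
    using C(3) that by (auto simp: E_def pairwise_def orthogonal_def)
  have expand: "f = (\<Sum>e\<in>E. inner f (sgn e) *\<^sub>R sgn e)" if "f \<in> F" for f
  proof -
    have "f \<in> span E" using that E(2) span_base by blast
    then obtain u where u: "f = (\<Sum>e\<in>E. u e *\<^sub>R e)"
      using E(1) by (auto simp: span_finite)
    have "inner f (sgn e) *\<^sub>R sgn e = u e *\<^sub>R e" if e: "e \<in> E" for e
    proof -
      have "inner f e = (\<Sum>x\<in>E. if x = e then u e * inner e e else 0)"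
        unfolding u inner_sum_left using orth e by (intro sum.cong) auto
      then have "inner f e = u e * (norm e)\<^sup>2"
        using e E(1) by (simp add: power2_norm_eq_inner)
      then show ?thesis
        using e by (simp add: E_def sgn_div_norm power2_eq_square)
    qed
    then show ?thesis using u by simp
  qed
  \<comment> \<open>Injectivity turns the sum over \<open>E\<close> into a sum over the set of
    normalized vectors.\<close>
  have "inj_on sgn E"
  proof (rule inj_onI)
    fix x y assume xy: "x \<in> E" "y \<in> E" "sgn x = sgn y"
    show "x = y"
    proof (rule ccontr)
      assume "x \<noteq> y"
      then have "inner (sgn x) (sgn y) = 0" using orth[OF xy(1,2)] by (simp add: sgn_div_norm)
      then have "sgn x = 0" using xy(3) by simp
      then show False using xy(1) by (simp add: E_def sgn_zero_iff)
    qed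
  qed
  then show ?thesis
    using that[of "sgn ` E"] E(1) expand by (simp add: sum.reindex)
qed

section \<open>Moments of words\<close>

definition moment :: "real \<Rightarrow> 'h::real_inner list \<Rightarrow> real" where
  "moment b w = pairing_sum b (\<lambda>i. w ! (i - 1)) (length w) {} {}"

text \<open>The case of \<open>pairing_sum_eq_fock_word\<close> without open positions, where the
  index is the vacuum and \<open>fock_norm\<close> is \<open>1\<close>. The reversal appears because
  the field of the first letter acts first.\<close>

lemma moment_eq_fock_word:
  assumes "0 \<le> b" "b \<le> 1" "finite E" "\<And>f. f \<in> set w \<Longrightarrow> f = (\<Sum>e\<in>E. inner f e *\<^sub>R e)"
  shows "moment b w = fock_word b E (rev w) ({#}, [])"
proof -
  let ?f = "\<lambda>i. w ! (i - 1)"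
  have "map ?f [1..<Suc (length w)] = w"
    by (intro nth_equalityI) (simp_all del: upt_Suc)
  then have "map ?f (rev [1..<Suc (length w)]) = rev w"
    by (metis rev_map)
  moreover have "?f i = (\<Sum>e\<in>E. inner (?f i) e *\<^sub>R e)" if "i \<in> {1..length w}" for i
    using that by (intro assms(4)) auto
  then have "pairing_sum b ?f (length w) (set []) {} = fock_norm b E (fock_code {} ?f []) *
      fock_word b E (map ?f (rev [1..<Suc (length w)])) (fock_code {} ?f [])"
    using assms(1-3) by (intro pairing_sum_eq_fock_word) auto
  ultimately show ?thesis
    by (simp add: moment_def fock_norm_def bos_norm_def del: upt_Suc)
qed

text \<open>The kernel is a Gram matrix of Fock vectors, so the double sum becomes a sum of squared
  moduli.\<close>

lemma moment_positive:
  fixes S :: "'h::real_inner list set"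
  assumes "0 \<le> b" "b \<le> 1" "finite S"
  shows "(\<Sum>u\<in>S. \<Sum>v\<in>S. cnj (c u) * c v * of_real (moment b (rev u @ v))) \<in> \<real>\<^sub>\<ge>\<^sub>0"
proof -
  \<comment> \<open>One \<open>E\<close> has to serve all words of \<open>S\<close>, so that their
    vectors are built from the same field operators.\<close>
  obtain E where E: "finite E" "\<And>f. f \<in> \<Union>(set ` S) \<Longrightarrow> f = (\<Sum>e\<in>E. inner f e *\<^sub>R e)"
    using finite_orthonormal_expansion[of "\<Union>(set ` S)"] assms(3) by blast
  let ?v = "fock_word b E"
  \<comment> \<open>A finite set containing the supports of all these vectors turns every inner
    product into a sum over the same range.\<close>
  define Z where "Z = (\<Union>u\<in>S. {z. ?v u z \<noteq> 0})"
  have Z: "finite Z" using assms(3) finite_support_word by (auto simp: Z_def finite_support_def)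
  have "moment b (rev u @ v) = (\<Sum>z\<in>Z. ?v u z * ?v v z)" if "u \<in> S" "v \<in> S" for u v
  proof -
    have "moment b (rev u @ v) = ?v (rev (rev u @ v)) ({#}, [])"
      using that assms E by (intro moment_eq_fock_word) auto
    also have "\<dots> = fock_inner (?v v) (?v u)"
      by (simp add: fock_inner_word)
    also have "\<dots> = (\<Sum>z\<in>Z. ?v v z * ?v u z)"
      using Z that by (intro fock_inner_superset) (auto simp: Z_def)
    finally show ?thesis by (simp add: mult.commute)
  qed
  then have "(\<Sum>u\<in>S. \<Sum>v\<in>S. cnj (c u) * c v * of_real (moment b (rev u @ v))) =
      (\<Sum>u\<in>S. \<Sum>v\<in>S. \<Sum>z\<in>Z. cnj (c u * of_real (?v u z)) * (c v * of_real (?v v z)))"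
    by (simp add: sum_distrib_left mult_ac)
  also have "\<dots> = (\<Sum>u\<in>S. \<Sum>z\<in>Z. \<Sum>v\<in>S. cnj (c u * of_real (?v u z)) * (c v * of_real (?v v z)))"
    by (intro sum.cong refl sum.swap)
  also have "\<dots> = (\<Sum>z\<in>Z. \<Sum>u\<in>S. \<Sum>v\<in>S. cnj (c u * of_real (?v u z)) * (c v * of_real (?v v z)))"
    by (rule sum.swap)
  also have "\<dots> = (\<Sum>z\<in>Z. cnj (\<Sum>u\<in>S. c u * of_real (?v u z)) * (\<Sum>v\<in>S. c v * of_real (?v v z)))"
    by (simp add: sum_product)
  also have "\<dots> = of_real (\<Sum>z\<in>Z. (cmod (\<Sum>u\<in>S. c u * of_real (?v u z)))\<^sup>2)"
    unfolding of_real_sum complex_norm_square by (simp add: mult.commute)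
  finally show ?thesis
    by (simp only: nonneg_Reals_of_real_iff) (simp add: sum_nonneg)
qed

text \<open>A finite set with a pair partition has an even number of points, so the sum is
  empty.\<close>

lemma moment_odd:
  assumes "odd (length w)"
  shows "moment b w = 0"
proof -
  have none: "{V. pair_partition_on {1..length w} V} = {}"
    using assms pair_partition_on_even[of "{1..length w}"] by auto
  show ?thesis
    unfolding moment_def pairing_sum_eq_moment none by simp
qed

lemma moment_even:
  "of_real (moment b (map f [1..<Suc (2 * n)])) =
     (\<Sum>V\<in>P2 n. t_fun b V * of_real (\<Prod>B\<in>V. inner (f (Min B)) (f (Max B))))"
proof -
  let ?w = "map f [1..<Suc (2 * n)]"
  have "(\<Prod>B\<in>V. inner (?w ! (Min B - 1)) (?w ! (Max B - 1))) = (\<Prod>B\<in>V. inner (f (Min B)) (f (Max B)))"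
    if V: "V \<in> P2 n" for V
  proof (rule prod.cong)
    fix B assume "B \<in> V"
    then have B: "B \<subseteq> {1..2 * n}" "card B = 2"
      using V pair_partition_onD(2,3) by (auto simp: P2_def)
    then have "finite B" "B \<noteq> {}" by (auto intro: card_ge_0_finite)
    then have "Min B \<in> {1..2 * n}" "Max B \<in> {1..2 * n}" using B(1) Min_in Max_in by blast+
    \<comment> \<open>Positions start at \<open>1\<close> and list indices at \<open>0\<close>; this
      undoes the shift \<open>i - 1\<close> in \<open>moment\<close>.\<close>
    moreover have "?w ! (i - 1) = f i" if "i \<in> {1..2 * n}" for i
      using that by (subst nth_map) (auto simp del: upt_Suc)
    ultimately show "inner (?w ! (Min B - 1)) (?w ! (Max B - 1)) = inner (f (Min B)) (f (Max B))"
      by presburger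
  qed simp
  then have *: "b ^ H V * (\<Prod>B\<in>V. inner (?w ! (Min B - 1)) (?w ! (Max B - 1))) =
      b ^ H V * (\<Prod>B\<in>V. inner (f (Min B)) (f (Max B)))" if "V \<in> P2 n" for V
    using that by simp
  have "moment b ?w = (\<Sum>V\<in>P2 n. b ^ H V * (\<Prod>B\<in>V. inner (?w ! (Min B - 1)) (?w ! (Max B - 1))))"
    by (simp add: moment_def pairing_sum_eq_moment P2_def del: upt_Suc)
  also have "\<dots> = (\<Sum>V\<in>P2 n. b ^ H V * (\<Prod>B\<in>V. inner (f (Min B)) (f (Max B))))"
    using * by (intro sum.cong refl)
  finally show ?thesis by (simp add: t_fun_def)
qed

theorem corollary1:
  fixes b :: real
  assumes "0 \<le> b" and "b \<le> 1"
  shows "strongly_multiplicative (t_fun b)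
    \<and> tracable (t_fun b)
    \<and> positive_definite TYPE('h::{real_inner, complete_space}) (t_fun b)"
proof (intro conjI strongly_multiplicative_t_fun tracable_t_fun)
  show "positive_definite TYPE('h) (t_fun b)"
  proof (rule positive_definite_of_moments[where \<phi> = "\<lambda>w. of_real (moment b w)"])
    show "of_real (moment b ([] :: 'h list)) = (1 :: complex)"
      by (simp add: moment_def pairing_sum_0)
    show "complex_of_real (moment b w) = 0" if "odd (length w)" for w :: "'h list"
      using moment_odd[OF that] by simp
  qed (use assms in \<open>simp_all only: moment_positive moment_even\<close>)
qed

end
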